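(* Every Archimedean map $\mathcal M$ on the torus has a unique minimal almost regular cover on the torus, and this cover can be constructed explicitly. That is: let $\tau$ be any Archimedean tessellation of the Euclidean plane, let $G \le T_\tau$ be generated by two linearly independent translations, and let $\mathcal M=\tau/G$. Then, among all toroidal maps $\tau/H$ that are almost regular and cover $\mathcal M$, there is exactly one that is minimal with respect to the covering order, and it can be constructed explicitly from a pair of generators of $G$.
   Context: A tessellation $\tau$ of the Euclidean plane by regular polygons (edge-to-edge) is Archimedean if its symmetry group acts transitively on its vertices. There are exactly 11 types: $\{3,6\}$, $\{4,4\}$, $\{6,3\}$, $(4.8^2)$, $(3.12^2)$, $(3.6.3.6)$, $(3.4.6.4)$, $(4.6.12)$, $(3^2.4.3.4)$, $(3^4.6)$, $(3^3.4^2)$, where $(p_1.p_2.\ldots.p_k)$ lists in cyclic order the polygons around a vertex. $\mathrm{Aut}(\tau)$ is the group of isometries of the plane preserving $\tau$, and $T_\tau\le \mathrm{Aut}(\tau)$ is the subgroup of all translations in it. Archimedean maps on the torus are exactly the quotients $\tau/G$, where $\tau$ is an Archimedean tessellation and $G\le T_\tau$ is generated by two linearly independent translations. A flag of $\tau$ is a triple of an incident vertex, edge and face; a flag of $\tau/G$ is a $G$-orbit of flags of $\tau$. The automorphism group $\mathrm{Aut}(\tau/G)$ is the group induced by the normalizer of $G$ in $\mathrm{Aut}(\tau)$, i.e. $\mathrm{Aut}(\tau/G)\cong \mathrm{Norm}_{\mathrm{Aut}(\tau)}(G)/G$. The map $\tau/G$ is called almost regular if its number of flag orbits under $\mathrm{Aut}(\tau/G)$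 equals the number of flag orbits of $\tau$ under $\mathrm{Aut}(\tau)$. The map $\tau/H$ is a cover of $\tau/G$ if $H\le G$; toroidal maps are partially ordered by: $\mathcal M\le\mathcal N$ iff $\mathcal N$ covers $\mathcal M$. A minimal almost regular cover of $\mathcal M$ is a minimal element, in this order, of the set of almost regular toroidal maps covering $\mathcal M$. *)

theory Defs
  imports
    "HOL-Analysis.Analysis"
    "HOL-Algebra.Group_Action"
    "HOL-Algebra.Generated_Groups"
begin

section \<open>Archimedean tessellations\<close>

text \<open>The Euclidean plane is the type \<^typ>\<open>complex\<close>; a tessellation is given by the set of its
  (closed) faces.\<close>

definition regular_polygon :: "complex set \<Rightarrow> bool" where
  "regular_polygon S \<longleftrightarrow>
     (\<exists>(n::nat) c w. n \<ge> 3 \<and> w \<noteq> 0 \<and>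
        S = convex hull ((\<lambda>k. c + w * cis (2 * pi * real k / real n)) ` {..<n}))"

text \<open>Two distinct faces of an edge-to-edge tessellation share nothing, one common vertex,
  or one common edge.\<close>

definition polygonal_tessellation :: "complex set set \<Rightarrow> bool" where
  "polygonal_tessellation \<tau> \<longleftrightarrow>
     (\<forall>S\<in>\<tau>. regular_polygon S) \<and>
     \<Union>\<tau> = UNIV \<and>
     (\<forall>S\<in>\<tau>. \<forall>T\<in>\<tau>. S \<noteq> T \<longrightarrow>
        interior S \<inter> interior T = {} \<and>
        (S \<inter> T = {} \<or>
         (\<exists>v. S \<inter> T = {v} \<and> v extreme_point_of S \<and> v extreme_point_of T) \<or>
         (S \<inter> T) edge_of S \<and> (S \<inter> T) edge_of T)) \<and>
     (\<forall>x. \<exists>r>0. finite {S\<in>\<tau>. S \<inter> ball x r \<noteq> {}})"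

definition vertices :: "complex set set \<Rightarrow> complex set" where
  "vertices \<tau> = {v. \<exists>S\<in>\<tau>. v extreme_point_of S}"

definition edges :: "complex set set \<Rightarrow> complex set set" where
  "edges \<tau> = {e. \<exists>S\<in>\<tau>. e edge_of S}"

definition symmetries :: "complex set set \<Rightarrow> (complex \<Rightarrow> complex) set" where
  "symmetries \<tau> = {f. surj f \<and> (\<forall>x y. dist (f x) (f y) = dist x y) \<and> (\<lambda>S. f ` S) ` \<tau> = \<tau>}"

definition Aut :: "complex set set \<Rightarrow> (complex \<Rightarrow> complex) monoid" where
  "Aut \<tau> = \<lparr>carrier = symmetries \<tau>, mult = (\<circ>), one = id\<rparr>"

definition translation_symmetries :: "complex set set \<Rightarrow> (complex \<Rightarrow> complex) set" where
  "translation_symmetries \<tau> = {f \<in> symmetries \<tau>. \<exists>t. f = (+) t}"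

definition archimedean :: "complex set set \<Rightarrow> bool" where
  "archimedean \<tau> \<longleftrightarrow>
     polygonal_tessellation \<tau> \<and>
     (\<forall>v\<in>vertices \<tau>. \<forall>w\<in>vertices \<tau>. \<exists>f\<in>symmetries \<tau>. f v = w)"


section \<open>Toroidal maps and their flags\<close>

text \<open>A toroidal map \<open>\<tau>/G\<close> is represented by the group \<open>G\<close>.\<close>

definition lin_indep :: "complex \<Rightarrow> complex \<Rightarrow> bool" where
  "lin_indep u v \<longleftrightarrow> u \<noteq> v \<and> independent {u, v}"

definition translation_group :: "complex set set \<Rightarrow> complex \<Rightarrow> complex \<Rightarrow> (complex \<Rightarrow> complex) set"
  where "translation_group \<tau> u v = generate (Aut \<tau>) {(+) u, (+) v}"

definition toroidal :: "complex set set \<Rightarrow> (complex \<Rightarrow> complex) set \<Rightarrow> bool" where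
  "toroidal \<tau> G \<longleftrightarrow>
     (\<exists>u v. (+) u \<in> translation_symmetries \<tau> \<and> (+) v \<in> translation_symmetries \<tau> \<and> lin_indep u v \<and>
            G = translation_group \<tau> u v)"

type_synonym flag = "complex \<times> complex set \<times> complex set"

definition flags :: "complex set set \<Rightarrow> flag set" where
  "flags \<tau> = {(v, e, S). v \<in> vertices \<tau> \<and> e \<in> edges \<tau> \<and> S \<in> \<tau> \<and> v \<in> e \<and> e \<subseteq> S}"

definition flag_act :: "(complex \<Rightarrow> complex) \<Rightarrow> flag \<Rightarrow> flag" where
  "flag_act f = (\<lambda>(v, e, S). (f v, f ` e, f ` S))"

definition map_flags :: "complex set set \<Rightarrow> (complex \<Rightarrow> complex) set \<Rightarrow> flag set set" where
  "map_flags \<tau> G = orbits (Aut \<tau>\<lparr>carrier := G\<rparr>) (flags \<tau>) flag_act"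

definition map_Aut ::
    "complex set set \<Rightarrow> (complex \<Rightarrow> complex) set \<Rightarrow> (complex \<Rightarrow> complex) set monoid" where
  "map_Aut \<tau> G = (Aut \<tau>\<lparr>carrier := normalizer (Aut \<tau>) G\<rparr>) Mod G"

text \<open>The coset \<open>Gf\<close> of an element \<open>f\<close> of the normalizer sends the orbit \<open>Gx\<close> to \<open>G(f x)\<close>, which is
  the set of all \<open>g y\<close> with \<open>g\<close> in \<open>Gf\<close> and \<open>y\<close> in \<open>Gx\<close>.\<close>

definition map_flag_act :: "(complex \<Rightarrow> complex) set \<Rightarrow> flag set \<Rightarrow> flag set" where
  "map_flag_act C X = (\<Union>g\<in>C. flag_act g ` X)"

text \<open>For toroidal maps both of the following sets of orbits are finite, so \<^const>\<open>card\<close> is the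
  actual number of orbits.\<close>

definition almost_regular :: "complex set set \<Rightarrow> (complex \<Rightarrow> complex) set \<Rightarrow> bool" where
  "almost_regular \<tau> G \<longleftrightarrow>
     card (orbits (map_Aut \<tau> G) (map_flags \<tau> G) map_flag_act) =
     card (orbits (Aut \<tau>) (flags \<tau>) flag_act)"


section \<open>Covers\<close>

text \<open>The order on toroidal maps is the reverse of inclusion of groups:
  \<open>\<tau>/G \<le> \<tau>/H\<close> iff \<open>\<tau>/H\<close> covers \<open>\<tau>/G\<close>, i.e. iff \<open>H \<le> G\<close>.\<close>

definition map_le :: "(complex \<Rightarrow> complex) set \<Rightarrow> (complex \<Rightarrow> complex) set \<Rightarrow> bool" where
  "map_le G H \<longleftrightarrow> H \<subseteq> G"

definition almost_regular_cover ::
    "complex set set \<Rightarrow> (complex \<Rightarrow> complex) set \<Rightarrow> (complex \<Rightarrow> complex) set \<Rightarrow> bool" where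
  "almost_regular_cover \<tau> G H \<longleftrightarrow> toroidal \<tau> H \<and> almost_regular \<tau> H \<and> map_le G H"

definition minimal_almost_regular_cover ::
    "complex set set \<Rightarrow> (complex \<Rightarrow> complex) set \<Rightarrow> (complex \<Rightarrow> complex) set \<Rightarrow> bool" where
  "minimal_almost_regular_cover \<tau> G H \<longleftrightarrow>
     almost_regular_cover \<tau> G H \<and>
     (\<forall>K. almost_regular_cover \<tau> G K \<and> map_le K H \<longrightarrow> K = H)"


section \<open>The explicit construction\<close>

text \<open>With respect to a basis \<open>(e\<^sub>1, e\<^sub>2)\<close> of the lattice of translation vectors of \<open>\<tau>\<close>, translations
  are pairs of integers, and the linear part of a symmetry is an integer matrix, given here by the
  pair of its columns.\<close>

type_synonym ivec = "int \<times> int"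

definition lattice_point :: "complex \<Rightarrow> complex \<Rightarrow> ivec \<Rightarrow> complex" where
  "lattice_point e1 e2 x = of_int (fst x) * e1 + of_int (snd x) * e2"

definition point_group_matrices ::
    "complex set set \<Rightarrow> complex \<Rightarrow> complex \<Rightarrow> (ivec \<times> ivec) set" where
  "point_group_matrices \<tau> e1 e2 =
     {(p, q). \<exists>f\<in>symmetries \<tau>. f e1 - f 0 = lattice_point e1 e2 p \<and>
                               f e2 - f 0 = lattice_point e1 e2 q}"

text \<open>The data of \<open>\<tau>\<close> that the construction uses: a basis of its translation lattice and the finite
  list of matrices of its point group.\<close>

definition symmetry_frame ::
    "complex set set \<Rightarrow> complex \<Rightarrow> complex \<Rightarrow> (ivec \<times> ivec) list \<Rightarrow> bool" where
  "symmetry_frame \<tau> e1 e2 P \<longleftrightarrow>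
     lin_indep e1 e2 \<and>
     {t. (+) t \<in> translation_symmetries \<tau>} = range (lattice_point e1 e2) \<and>
     set P = point_group_matrices \<tau> e1 e2"

definition cross :: "ivec \<Rightarrow> ivec \<Rightarrow> int" where
  "cross x y = fst x * snd y - snd x * fst y"

definition mat_apply :: "ivec \<times> ivec \<Rightarrow> ivec \<Rightarrow> ivec" where
  "mat_apply A x = (fst x * fst (fst A) + snd x * fst (snd A),
                    fst x * snd (fst A) + snd x * snd (snd A))"

text \<open>Cramer's rule: if \<open>cross a b \<noteq> 0\<close>, this decides whether \<open>x\<close> is an integer combination of \<open>a\<close>
  and \<open>b\<close>.\<close>

definition in_lattice :: "ivec \<Rightarrow> ivec \<Rightarrow> ivec \<Rightarrow> bool" where
  "in_lattice a b x \<longleftrightarrow> cross a b dvd cross x b \<and> cross a b dvd cross a x"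

text \<open>The lattice of all \<open>x\<close> whose images under the point group all lie in the lattice spanned by \<open>a\<close>
  and \<open>b\<close> contains \<open>n\<int>\<^sup>2\<close>, where \<open>n\<close> is the absolute value of \<open>cross a b\<close>. Its triangular (Hermite)
  basis is therefore found by a search through finitely many integer vectors.\<close>

definition cover_generators :: "(ivec \<times> ivec) list \<Rightarrow> ivec \<Rightarrow> ivec \<Rightarrow> ivec \<times> ivec" where
  "cover_generators P a b =
     (let n = \<bar>cross a b\<bar>;
          admissible = (\<lambda>x. \<forall>A\<in>set P. in_lattice a b (mat_apply A x))
      in (hd (filter admissible [(i, j). i \<leftarrow> [1..n], j \<leftarrow> [0..n - 1]]),
          hd (filter admissible [(0, j). j \<leftarrow> [1..n]])))"

end

theory Submission
  imports Defs
begin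

text \<open>
  Every symmetry \<open>f\<close> acts on translation vectors through its linear part \<open>x \<mapsto> f x - f 0\<close>, and
  conjugating the translation by \<open>t\<close> with \<open>f\<close> gives the translation by the image of \<open>t\<close> under this
  linear part. So \<open>\<tau>/H\<close>, where \<open>H\<close> consists of the translations by a lattice \<open>L\<close>, has the linear
  stabilizer of \<open>L\<close> as the normalizer of \<open>H\<close>. The symmetry group acts freely on flags
  (\<open>flag_fixed\<close>), so a proper subgroup of it with finitely many flag orbits has strictly more of
  them than the whole group (\<open>flag_orbit_count_eq_iff\<close>). Hence \<open>\<tau>/H\<close> is almost regular iff all
  symmetries preserve \<open>L\<close> (\<open>almost_regular_iff\<close>).

  Among the sublattices of a lattice \<open>L\<close> that all symmetries preserve there is a greatest one, namely
  the set of all translation vectors of \<open>\<tau>\<close> whose images under all linear parts lie in \<open>L\<close>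
  (\<open>invariant_core\<close>). A greatest almost regular subgroup of \<open>G\<close> is the same thing as a least almost
  regular cover of \<open>\<tau>/G\<close>, and a least cover is the only minimal one. What remains is to see that
  the invariant core has full rank and that \<open>cover_generators\<close> finds a basis of it. In
  coordinates it contains \<open>n\<int>\<^sup>2\<close>, where \<open>n\<close> is the index of \<open>L\<close>, so it has a triangular basis with
  entries at most \<open>n\<close> and the search succeeds (\<open>hermite_basis\<close>).

  The coordinates exist because the translation vectors of \<open>\<tau>\<close> form a lattice of rank two. The
  classification of the eleven Archimedean tessellations is replaced by an argument in the manner of
  Bieberbach: the orbit of a vertex is relatively dense in the plane, whereas a group of isometries
  whose translations are all parallel keeps the orbits of points in a strip
  (\<open>two_independent_translations\<close>). Local finiteness then makes the translation vectors discrete.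
\<close>

section \<open>Isometries of the plane\<close>

definition linear_part :: "(complex \<Rightarrow> complex) \<Rightarrow> complex \<Rightarrow> complex" where
  "linear_part f x = f x - f 0"

definition isometry :: "(complex \<Rightarrow> complex) \<Rightarrow> bool" where
  "isometry f \<longleftrightarrow> (\<forall>x y. dist (f x) (f y) = dist x y)"

lemma orthogonal_linear_part:
  assumes "isometry f"
  shows "orthogonal_transformation (linear_part f)"
  using assms unfolding orthogonal_transformation_isometry isometry_def linear_part_def
  by (simp add: dist_norm)

lemma linear_linear_part: "isometry f \<Longrightarrow> linear (linear_part f)"
  using orthogonal_linear_part orthogonal_transformation_linear by blast

lemma norm_linear_part: "isometry f \<Longrightarrow> norm (linear_part f x) = norm x"
  using orthogonal_linear_part orthogonal_transformation_norm by blast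

lemma isometry_split: "f x = f 0 + linear_part f x"
  by (simp add: linear_part_def)

lemma isometry_add: "isometry f \<Longrightarrow> f (x + y) = f x + linear_part f y"
  using linear_add[OF linear_linear_part, of f x y] by (simp add: linear_part_def algebra_simps)

lemma isometry_diff: "isometry f \<Longrightarrow> f x - f y = linear_part f (x - y)"
  using linear_diff[OF linear_linear_part, of f x y] by (simp add: linear_part_def algebra_simps)

lemma inj_isometry: "isometry f \<Longrightarrow> inj f"
  unfolding isometry_def inj_def by (metis dist_eq_0_iff)

lemma linear_part_comp: "isometry f \<Longrightarrow> linear_part (f \<circ> g) x = linear_part f (linear_part g x)"
  using isometry_diff[of f "g x" "g 0"] by (simp add: linear_part_def)

lemma isometry_cases:
  assumes "isometry f"
  obtains (rotation) a b where "norm a = 1" "f = (\<lambda>z. a * z + b)"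
        | (reflection) a b where "norm a = 1" "f = (\<lambda>z. a * cnj z + b)"
proof -
  let ?L = "linear_part f"
  define a where "a = ?L 1"
  define c where "c = ?L \<i>"
  have a: "norm a = 1" and c: "norm c = 1"
    using norm_linear_part[OF assms] by (simp_all add: a_def c_def)
  have L: "?L z = of_real (Re z) * a + of_real (Im z) * c" for z
  proof -
    have "z = Re z *\<^sub>R 1 + Im z *\<^sub>R \<i>"
      by (simp add: complex_eq_iff)
    then have "?L z = ?L (Re z *\<^sub>R 1 + Im z *\<^sub>R \<i>)" by simp
    also have "\<dots> = Re z *\<^sub>R a + Im z *\<^sub>R c"
      unfolding a_def c_def
      using linear_linear_part[OF assms] by (simp only: linear_add linear_scale)
    finally show ?thesis by (simp add: scaleR_conv_of_real)
  qed
  have "a \<bullet> c = 0"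
    using orthogonal_linear_part[OF assms]
    by (simp add: orthogonal_transformation_def a_def c_def inner_complex_def)
  then have ac: "Re a * Re c + Im a * Im c = 0" by (simp add: inner_complex_def)
  have a2: "(Re a)\<^sup>2 + (Im a)\<^sup>2 = 1" and c2: "(Re c)\<^sup>2 + (Im c)\<^sup>2 = 1"
    using a c by (simp_all add: cmod_def)
  define s where "s = Re a * Im c - Im a * Re c"
  have cs: "c = of_real s * (\<i> * a)"
  proof -
    have "Re c = - s * Im a" "Im c = s * Re a"
      unfolding s_def using ac a2 by algebra+
    then show ?thesis by (simp add: complex_eq_iff)
  qed
  have "s\<^sup>2 = 1"
    unfolding s_def using ac a2 c2 by algebra
  then have "s = 1 \<or> s = -1" by (simp add: power2_eq_1_iff)
  then show ?thesis
  proof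
    assume "s = 1"
    then have "f z = a * z + f 0" for z
      using isometry_split[of f z] L[of z] cs by (simp add: complex_eq_iff algebra_simps)
    with a rotation show thesis by blast
  next
    assume "s = -1"
    then have "f z = a * cnj z + f 0" for z
      using isometry_split[of f z] L[of z] cs by (simp add: complex_eq_iff algebra_simps)
    with a reflection show thesis by blast
  qed
qed

lemma inv_rotation:
  assumes "norm a = 1"
  shows "inv_into UNIV (\<lambda>z. a * z + b) = (\<lambda>z. (z - b) / (a::complex))"
proof -
  have "a \<noteq> 0" using assms by auto
  then show ?thesis by (intro inv_unique_comp) (auto simp: fun_eq_iff)
qed

text \<open>The commutator of two orientation-preserving elements is a translation, and it is trivial only if
  the two commute. If \<open>\<Gamma>\<close> has no nontrivial translation, the orientation-preserving elements therefore
  share a fixed point or are all trivial, so that orbits are bounded. If all translations are parallel to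
  some \<open>t \<noteq> 0\<close>, every rotation must preserve the direction of \<open>t\<close> and is a half-turn, so the
  orientation-preserving part moves a point within two lines parallel to \<open>t\<close>. In both cases the
  orbits have bounded width in some direction, and the orientation-reversing elements contribute one
  further orbit. A relatively dense orbit has unbounded width in every direction.\<close>

lemma two_independent_translations:
  fixes \<Gamma> :: "(complex \<Rightarrow> complex) set"
  assumes iso: "\<And>f. f \<in> \<Gamma> \<Longrightarrow> isometry f"
    and comp: "\<And>f g. f \<in> \<Gamma> \<Longrightarrow> g \<in> \<Gamma> \<Longrightarrow> f \<circ> g \<in> \<Gamma>"
    and inv: "\<And>f. f \<in> \<Gamma> \<Longrightarrow> inv_into UNIV f \<in> \<Gamma>"
    and dense: "\<And>x. \<exists>f\<in>\<Gamma>. dist x (f v) \<le> D"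
  shows "\<exists>s t. (+) s \<in> \<Gamma> \<and> (+) t \<in> \<Gamma> \<and> Im (cnj s * t) \<noteq> 0"
proof (rule ccontr)
  assume "\<not> ?thesis"
  then have parallel: "Im (cnj s * t) = 0" if "(+) s \<in> \<Gamma>" "(+) t \<in> \<Gamma>" for s t
    using that by blast
  \<comment> \<open>The distance of \<open>z\<close> from the line through the origin in direction \<open>d\<close> is, up to the factor
    \<open>norm d\<close>, the absolute value of \<open>Im (cnj d * z)\<close>.\<close>
  have bounded_width: "\<exists>d. d \<noteq> 0 \<and>
    (\<forall>w. \<exists>C. \<forall>a b. norm a = 1 \<and> (\<lambda>z. a * z + b) \<in> \<Gamma> \<longrightarrow> \<bar>Im (cnj d * (a * w + b))\<bar> \<le> C)"
  proof (cases "\<exists>t. t \<noteq> 0 \<and> (+) t \<in> \<Gamma>")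
    case True
    then obtain t where t: "t \<noteq> 0" "(+) t \<in> \<Gamma>" by blast
    have pm: "a = 1 \<or> a = -1" if a: "norm a = 1" "(\<lambda>z. a * z + b) \<in> \<Gamma>" for a b
    proof -
      have "a \<noteq> 0" using a by auto
      have "(\<lambda>z. a * z + b) \<circ> ((+) t \<circ> inv_into UNIV (\<lambda>z. a * z + b)) \<in> \<Gamma>"
        using a t inv comp by blast
      moreover have "(\<lambda>z. a * z + b) \<circ> ((+) t \<circ> inv_into UNIV (\<lambda>z. a * z + b)) = (+) (a * t)"
        unfolding inv_rotation[OF a(1)] using \<open>a \<noteq> 0\<close> by (auto simp: fun_eq_iff field_simps)
      ultimately have "Im (cnj t * (a * t)) = 0" using parallel[OF t(2)] by metis
      moreover have "cnj t * (a * t) = of_real ((norm t)\<^sup>2) * a"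
        unfolding complex_norm_square by (simp only: ac_simps)
      ultimately have "Im (of_real ((norm t)\<^sup>2) * a) = 0" by metis
      then have "(norm t)\<^sup>2 * Im a = 0"
        unfolding times_complex.sel Re_complex_of_real Im_complex_of_real by simp
      then have "Im a = 0" using t by simp
      then show ?thesis using a(1) by (auto simp: cmod_def complex_eq_iff)
    qed
    show ?thesis
    proof (intro exI[of _ t] conjI allI)
      fix w
      show "\<exists>C. \<forall>a b. norm a = 1 \<and> (\<lambda>z. a * z + b) \<in> \<Gamma> \<longrightarrow> \<bar>Im (cnj t * (a * w + b))\<bar> \<le> C"
      proof (cases "\<exists>b0. (\<lambda>z. - z + b0) \<in> \<Gamma>")
        case False
        have "\<bar>Im (cnj t * (a * w + b))\<bar> \<le> \<bar>Im (cnj t * w)\<bar>"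
          if a: "norm a = 1" "(\<lambda>z. a * z + b) \<in> \<Gamma>" for a b
        proof -
          have "a = 1" using pm[OF a] a(2) False by auto
          moreover then have "(+) b \<in> \<Gamma>" using a(2) by (simp add: add.commute[of _ b])
          ultimately show ?thesis using parallel[OF t(2)] by (simp add: algebra_simps)
        qed
        then show ?thesis by blast
      next
        case True
        then obtain b0 where b0: "(\<lambda>z. - z + b0) \<in> \<Gamma>" by blast
        have "\<bar>Im (cnj t * (a * w + b))\<bar> \<le> max \<bar>Im (cnj t * w)\<bar> \<bar>Im (cnj t * (- w + b0))\<bar>"
          if a: "norm a = 1" "(\<lambda>z. a * z + b) \<in> \<Gamma>" for a b
          using pm[OF a]
        proof
          assume "a = 1"
          moreover then have "(+) b \<in> \<Gamma>" using a(2) by (simp add: add.commute[of _ b])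
          ultimately show ?thesis using parallel[OF t(2)] by (simp add: algebra_simps)
        next
          assume a1: "a = -1"
          have "(\<lambda>z. a * z + b) \<circ> (\<lambda>z. - z + b0) \<in> \<Gamma>" using a(2) b0 comp by blast
          moreover have "(\<lambda>z. a * z + b) \<circ> (\<lambda>z. - z + b0) = (+) (b - b0)"
            using a1 by (auto simp: fun_eq_iff)
          ultimately have "Im (cnj t * (b - b0)) = 0" using parallel[OF t(2)] by metis
          then show ?thesis using a1 by (simp add: algebra_simps)
        qed
        then show ?thesis by blast
      qed
    qed (use t in auto)
  next
    case False
    have no_translation: "t = 0" if "(+) t \<in> \<Gamma>" for t using False that by blast
    have commute: "(1 - c) * b = (1 - a) * d"
      if a: "norm a = 1" "(\<lambda>z. a * z + b) \<in> \<Gamma>" and c: "norm c = 1" "(\<lambda>z. c * z + d) \<in> \<Gamma>"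
      for a b c d
    proof -
      have nz: "a \<noteq> 0" "c \<noteq> 0" using a c by auto
      let ?f = "\<lambda>z. a * z + b" and ?g = "\<lambda>z. c * z + d"
      have "?f \<circ> (?g \<circ> (inv_into UNIV ?f \<circ> inv_into UNIV ?g)) \<in> \<Gamma>" using a c inv comp by meson
      moreover have "?f \<circ> (?g \<circ> (inv_into UNIV ?f \<circ> inv_into UNIV ?g)) = (+) ((1 - c) * b - (1 - a) * d)"
        unfolding inv_rotation[OF a(1)] inv_rotation[OF c(1)]
        using nz by (auto simp: fun_eq_iff field_simps)
      ultimately show ?thesis using no_translation by fastforce
    qed
    have "\<exists>C. \<forall>a b. norm a = 1 \<and> (\<lambda>z. a * z + b) \<in> \<Gamma> \<longrightarrow> norm (a * w + b) \<le> C" for w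
    proof (cases "\<exists>a b. a \<noteq> 1 \<and> norm a = 1 \<and> (\<lambda>z. a * z + b) \<in> \<Gamma>")
      case True
      then obtain a0 b0 where a0: "a0 \<noteq> 1" "norm a0 = 1" "(\<lambda>z. a0 * z + b0) \<in> \<Gamma>" by blast
      define p where "p = b0 / (1 - a0)"
      have "norm (a * w + b) \<le> norm p + norm (w - p)"
        if a: "norm a = 1" "(\<lambda>z. a * z + b) \<in> \<Gamma>" for a b
      proof -
        have "b = (1 - a) * p" using commute[OF a0(2,3) a] a0(1) by (simp add: p_def field_simps)
        then have "a * w + b = p + a * (w - p)" by (simp add: algebra_simps)
        then have "norm (a * w + b) \<le> norm p + norm (a * (w - p))" by (metis norm_triangle_ineq)
        then show ?thesis using a(1) by (simp add: norm_mult)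
      qed
      then show ?thesis by blast
    next
      case False
      have "norm (a * w + b) \<le> norm w"
        if a: "norm a = 1" "(\<lambda>z. a * z + b) \<in> \<Gamma>" for a b
      proof -
        have "a = 1" using False a by blast
        moreover then have "(+) b \<in> \<Gamma>" using a(2) by (simp add: add.commute[of _ b])
        ultimately show ?thesis using no_translation by fastforce
      qed
      then show ?thesis by blast
    qed
    then have "\<exists>C. \<forall>a b. norm a = 1 \<and> (\<lambda>z. a * z + b) \<in> \<Gamma> \<longrightarrow> \<bar>Im (cnj 1 * (a * w + b))\<bar> \<le> C" for w
      by (metis abs_Im_le_cmod complex_cnj_one mult_1 order_trans)
    then show ?thesis by (intro exI[of _ 1]) auto
  qed
  then obtain d where d: "d \<noteq> 0"
    and width: "\<And>w. \<exists>C. \<forall>a b. norm a = 1 \<and> (\<lambda>z. a * z + b) \<in> \<Gamma> \<longrightarrow> \<bar>Im (cnj d * (a * w + b))\<bar> \<le> C"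
    by blast
  have "\<exists>C. \<forall>f\<in>\<Gamma>. \<bar>Im (cnj d * f v)\<bar> \<le> C"
  proof -
    obtain C where C: "\<And>a b. norm a = 1 \<Longrightarrow> (\<lambda>z. a * z + b) \<in> \<Gamma> \<Longrightarrow> \<bar>Im (cnj d * (a * v + b))\<bar> \<le> C"
      using width by blast
    show ?thesis
    proof (cases "\<exists>a b. norm a = 1 \<and> (\<lambda>z. a * cnj z + b) \<in> \<Gamma>")
      case False
      have "\<bar>Im (cnj d * f v)\<bar> \<le> C" if "f \<in> \<Gamma>" for f
        using iso[OF that] by (cases rule: isometry_cases) (use C that False in auto)
      then show ?thesis by blast
    next
      case True
      then obtain a0 b0 where r: "norm a0 = 1" "(\<lambda>z. a0 * cnj z + b0) \<in> \<Gamma>" by blast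
      \<comment> \<open>Composing with one fixed reflection turns an orientation-reversing element into an
        orientation-preserving one, applied to the preimage of \<open>v\<close>.\<close>
      let ?r = "\<lambda>z. a0 * cnj z + b0"
      obtain C' where C': "\<And>a b. norm a = 1 \<Longrightarrow> (\<lambda>z. a * z + b) \<in> \<Gamma>
          \<Longrightarrow> \<bar>Im (cnj d * (a * inv_into UNIV ?r v + b))\<bar> \<le> C'"
        using width by blast
      have a0: "a0 \<noteq> 0" using r by auto
      have "bij ?r"
        by (rule o_bij[of "\<lambda>z. cnj ((z - b0) / a0)"]) (use a0 in \<open>auto simp: fun_eq_iff\<close>)
      then have rv: "?r (inv_into UNIV ?r v) = v" by (meson bij_inv_eq_iff)
      have "\<bar>Im (cnj d * f v)\<bar> \<le> max C C'" if f: "f \<in> \<Gamma>" for f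
        using iso[OF f]
      proof (cases rule: isometry_cases)
        case (rotation a b)
        then show ?thesis using C[of a b] f by auto
      next
        case (reflection a b)
        have "f \<circ> ?r \<in> \<Gamma>" using f r comp by blast
        moreover have eq: "f \<circ> ?r = (\<lambda>z. (a * cnj a0) * z + (a * cnj b0 + b))"
          by (auto simp: reflection fun_eq_iff algebra_simps)
        ultimately have "\<bar>Im (cnj d * ((a * cnj a0) * inv_into UNIV ?r v + (a * cnj b0 + b)))\<bar> \<le> C'"
          using C'[of "a * cnj a0" "a * cnj b0 + b"] reflection r by (simp add: norm_mult)
        moreover have "(a * cnj a0) * inv_into UNIV ?r v + (a * cnj b0 + b) = f v"
          using fun_cong[OF eq, of "inv_into UNIV ?r v"] rv by simp
        ultimately show ?thesis by simp
      qed
      then show ?thesis by blast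
    qed
  qed
  then obtain C where C: "\<And>f. f \<in> \<Gamma> \<Longrightarrow> \<bar>Im (cnj d * f v)\<bar> \<le> C" by blast
  \<comment> \<open>A point too far from the strip, in the direction orthogonal to \<open>d\<close>.\<close>
  define x where "x = of_real (\<bar>C\<bar> + norm d * \<bar>D\<bar> + 1) * (\<i> * d) / of_real ((norm d)\<^sup>2)"
  obtain f where f: "f \<in> \<Gamma>" "dist x (f v) \<le> D" using dense by blast
  have "cnj d * x = of_real (\<bar>C\<bar> + norm d * \<bar>D\<bar> + 1) * \<i> * (d * cnj d) / of_real ((norm d)\<^sup>2)"
    by (simp add: x_def)
  also have "\<dots> = of_real (\<bar>C\<bar> + norm d * \<bar>D\<bar> + 1) * \<i>"
    unfolding complex_norm_square[symmetric] using d by simp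
  finally have "Im (cnj d * x) = \<bar>C\<bar> + norm d * \<bar>D\<bar> + 1" by simp
  moreover have "\<bar>Im (cnj d * (x - f v))\<bar> \<le> norm d * \<bar>D\<bar>"
  proof -
    have "\<bar>Im (cnj d * (x - f v))\<bar> \<le> norm (cnj d * (x - f v))" by (rule abs_Im_le_cmod)
    also have "\<dots> \<le> norm d * \<bar>D\<bar>"
      unfolding norm_mult complex_mod_cnj by (intro mult_left_mono) (use f in \<open>auto simp: dist_norm\<close>)
    finally show ?thesis .
  qed
  ultimately show False using C[OF f(1)] by (simp add: algebra_simps)
qed

section \<open>Plane lattices\<close>

lemma lin_indep_iff: "lin_indep u v \<longleftrightarrow> Im (cnj u * v) \<noteq> 0"
proof (cases "v = 0")
  case True
  then show ?thesis by (auto simp: lin_indep_def dependent_zero)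
next
  case False
  have "Im (cnj u * v) = 0 \<longleftrightarrow> u \<in> span {v}"
  proof
    assume eq: "Im (cnj u * v) = 0"
    have "u / v = cnj (cnj u * v) / (v * cnj v)"
      using False by (simp add: field_simps)
    also have "\<dots> = cnj (cnj u * v) / of_real ((norm v)\<^sup>2)"
      by (simp only: complex_norm_square)
    finally have "u / v = cnj (cnj u * v) / of_real ((norm v)\<^sup>2)" .
    then have "Im (u / v) = - Im (cnj u * v) / (norm v)\<^sup>2" by (simp only: Im_divide_of_real cnj.sel)
    then have "Im (u / v) = 0" using eq by simp
    then have "u / v = of_real (Re (u / v))" by (simp add: complex_eq_iff)
    then have "u = Re (u / v) *\<^sub>R v" using False by (simp add: scaleR_conv_of_real field_simps)
    then show "u \<in> span {v}" by (metis span_base span_scale singletonI)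
  next
    assume "u \<in> span {v}"
    then obtain k where "u = k *\<^sub>R v" by (auto simp: span_singleton)
    then show "Im (cnj u * v) = 0" by simp
  qed
  then show ?thesis
    using False by (auto simp: lin_indep_def independent_insert span_base)
qed

lemma lattice_point_add:
  "lattice_point e1 e2 (i + k, j + l) = lattice_point e1 e2 (i, j) + lattice_point e1 e2 (k, l)"
  by (simp add: lattice_point_def algebra_simps)

lemma real_coordinates:
  assumes "Im (cnj e1 * e2) \<noteq> 0"
  obtains x y :: real where "z = of_real x * e1 + of_real y * e2"
proof
  let ?D = "Im (cnj e1 * e2)"
  show "z = of_real (Im (cnj z * e2) / ?D) * e1 + of_real (Im (cnj e1 * z) / ?D) * e2"
  proof -
    have "?D * Re z = Im (cnj z * e2) * Re e1 + Im (cnj e1 * z) * Re e2"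
      "?D * Im z = Im (cnj z * e2) * Im e1 + Im (cnj e1 * z) * Im e2"
      by (simp_all add: algebra_simps)
    moreover have "x = n / d" if "d \<noteq> 0" "d * x = n" for d x n :: real
      using that by auto
    ultimately have "Re z = (Im (cnj z * e2) * Re e1 + Im (cnj e1 * z) * Re e2) / ?D"
      "Im z = (Im (cnj z * e2) * Im e1 + Im (cnj e1 * z) * Im e2) / ?D"
      using assms by blast+
    moreover have "Re (of_real (p / d) * e1 + of_real (q / d) * e2) = (p * Re e1 + q * Re e2) / d"
      "Im (of_real (p / d) * e1 + of_real (q / d) * e2) = (p * Im e1 + q * Im e2) / d"
      for p q d by (simp_all add: add_divide_distrib)
    ultimately show ?thesis unfolding complex_eq_iff by presburger
  qed
qed

lemma Im_cnj_combination:
  fixes x y :: real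
  shows "Im (cnj e1 * (of_real x * e1 + of_real y * e2)) = y * Im (cnj e1 * e2)"
  by (simp add: algebra_simps)

lemma inner_bound:
  fixes e1 e2 :: complex
  assumes "Im (cnj e1 * e2) \<noteq> 0"
  shows "(e1 \<bullet> e2)\<^sup>2 < (norm e1)\<^sup>2 * (norm e2)\<^sup>2"
proof -
  have "(norm e1)\<^sup>2 * (norm e2)\<^sup>2 = (e1 \<bullet> e2)\<^sup>2 + (Im (cnj e1 * e2))\<^sup>2"
    unfolding cmod_power2 inner_complex_def by (simp add: power2_eq_square algebra_simps)
  then show ?thesis using assms by (simp add: zero_less_power2)
qed

text \<open>Gauss reduction: reducing the coordinates of a vector to \<open>[-1/2, 1/2]\<close> makes it strictly shorter than
  the longer basis vector. Strictness, which the choice of a shortest \<open>e2\<close> below depends on, comes from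
  the strict Cauchy-Schwarz inequality for independent vectors.\<close>

lemma norm_reduced:
  fixes e1 e2 :: complex and x y :: real
  assumes ind: "Im (cnj e1 * e2) \<noteq> 0" and le: "norm e1 \<le> norm e2"
    and x: "\<bar>x\<bar> \<le> 1/2" and y: "\<bar>y\<bar> \<le> 1/2"
  shows "norm (of_real x * e1 + of_real y * e2) < norm e2"
proof -
  let ?c = "e1 \<bullet> e2" and ?E = "(norm e2)\<^sup>2"
  have le2: "(norm e1)\<^sup>2 \<le> ?E" using le by (simp add: power_mono)
  have "?c\<^sup>2 < (norm e1)\<^sup>2 * ?E" by (rule inner_bound[OF ind])
  also have "\<dots> \<le> ?E\<^sup>2" using le2 by (simp add: power2_eq_square mult_right_mono)
  finally have c: "\<bar>?c\<bar> < ?E" by (metis abs_le_square_iff abs_power2 not_less)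
  have x2: "x\<^sup>2 \<le> 1/4" and y2: "y\<^sup>2 \<le> 1/4"
    using power_mono[OF x, of 2] power_mono[OF y, of 2] by (simp_all add: power2_eq_square)
  have "(norm (of_real x * e1 + of_real y * e2))\<^sup>2 = x\<^sup>2 * (norm e1)\<^sup>2 + 2 * ((x * y) * ?c) + y\<^sup>2 * ?E"
    unfolding cmod_power2 inner_complex_def by (simp add: power2_eq_square algebra_simps)
  also have "\<dots> \<le> 1/4 * ?E + 2 * (1/4 * \<bar>?c\<bar>) + 1/4 * ?E"
  proof (intro add_mono mult_left_mono)
    show "x\<^sup>2 * (norm e1)\<^sup>2 \<le> 1/4 * ?E" using x2 le2 by (intro mult_mono) auto
    show "y\<^sup>2 * ?E \<le> 1/4 * ?E" using y2 by (intro mult_right_mono) auto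
    have "\<bar>x * y\<bar> \<le> 1/2 * (1/2)" unfolding abs_mult using x y by (intro mult_mono) auto
    then have "\<bar>x * y\<bar> * \<bar>?c\<bar> \<le> 1/4 * \<bar>?c\<bar>" by (intro mult_right_mono) auto
    then show "(x * y) * ?c \<le> 1/4 * \<bar>?c\<bar>" by (metis abs_ge_self abs_mult order_trans)
  qed auto
  also have "\<dots> < ?E" using c by simp
  finally show ?thesis by (simp add: power2_less_imp_less)
qed

lemma norm_minimal_element:
  fixes A :: "complex set"
  assumes "A \<noteq> {}" "\<And>r. finite (A \<inter> cball 0 r)"
  obtains m where "m \<in> A" "\<And>x. x \<in> A \<Longrightarrow> norm m \<le> norm x"
proof -
  obtain a where a: "a \<in> A" using assms by blast
  let ?B = "A \<inter> cball 0 (norm a)"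
  have "finite (norm ` ?B)" "norm ` ?B \<noteq> {}" using assms a by auto
  then obtain m where "m \<in> ?B" "\<And>x. x \<in> ?B \<Longrightarrow> norm m \<le> norm x"
    using Min_in[of "norm ` ?B"] Min_le[of "norm ` ?B"] by (metis (no_types, lifting) image_iff)
  then show ?thesis using that[of m] a by (smt (verit) IntD1 IntI mem_cball_0)
qed

text \<open>A shortest nonzero vector \<open>e1\<close> and a shortest vector \<open>e2\<close> independent of it form a basis: rounding
  the real coordinates of a vector to integers leaves a remainder that is too short to be nonzero.\<close>

lemma discrete_subgroup_basis:
  fixes L :: "complex set"
  assumes diff: "\<And>x y. x \<in> L \<Longrightarrow> y \<in> L \<Longrightarrow> x - y \<in> L"
    and fin: "\<And>r. finite (L \<inter> cball 0 r)"
    and st: "s \<in> L" "t \<in> L" "Im (cnj s * t) \<noteq> 0"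
  obtains e1 e2 where "Im (cnj e1 * e2) \<noteq> 0" "L = range (lattice_point e1 e2)"
proof -
  have zero: "0 \<in> L" using diff[OF st(1) st(1)] by simp
  then have minus: "x \<in> L \<Longrightarrow> - x \<in> L" for x using diff[of 0 x] by simp
  have add: "x \<in> L \<Longrightarrow> y \<in> L \<Longrightarrow> x + y \<in> L" for x y using diff[of x "- y"] minus by simp
  have mult: "of_int m * x \<in> L" if x: "x \<in> L" for m x
  proof (induction m rule: int_induct[where k = 0])
    case base
    then show ?case using zero by simp
  next
    case (step1 i)
    then show ?case using add[OF step1(2) x] by (simp add: algebra_simps)
  next
    case (step2 i)
    then show ?case using diff[OF step2(2) x] by (simp add: algebra_simps)
  qed
  have "s \<noteq> 0" using st by auto
  then have "L - {0} \<noteq> {}" using st by blast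
  moreover have "finite ((L - {0}) \<inter> cball 0 r)" for r by (rule finite_subset[OF _ fin[of r]]) auto
  ultimately obtain e1 where e1: "e1 \<in> L" "e1 \<noteq> 0" and e1_min: "\<And>x. x \<in> L \<Longrightarrow> x \<noteq> 0 \<Longrightarrow> norm e1 \<le> norm x"
    by (rule norm_minimal_element) auto
  let ?M = "{x \<in> L. Im (cnj e1 * x) \<noteq> 0}"
  have "?M \<noteq> {}"
  proof
    assume "?M = {}"
    then have 1: "Re e1 * Im s = Im e1 * Re s" and 2: "Re e1 * Im t = Im e1 * Re t"
      using st by auto
    have 3: "Re e1 \<noteq> 0 \<or> Im e1 \<noteq> 0" using e1 by (auto simp: complex_eq_iff)
    have "Re e1 * (Re s * Im t - Im s * Re t) = 0" "Im e1 * (Re s * Im t - Im s * Re t) = 0"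
      using 1 2 by algebra+
    then show False using 3 st by auto
  qed
  moreover have "finite (?M \<inter> cball 0 r)" for r by (rule finite_subset[OF _ fin[of r]]) auto
  ultimately obtain e2 where e2: "e2 \<in> L" "Im (cnj e1 * e2) \<noteq> 0"
    and e2_min: "\<And>x. x \<in> L \<Longrightarrow> Im (cnj e1 * x) \<noteq> 0 \<Longrightarrow> norm e2 \<le> norm x"
    by (rule norm_minimal_element) auto
  have le: "norm e1 \<le> norm e2" using e1_min[of e2] e2 by force
  have "L = range (lattice_point e1 e2)"
  proof
    show "range (lattice_point e1 e2) \<subseteq> L"
      unfolding lattice_point_def using add mult e1 e2 by blast
    show "L \<subseteq> range (lattice_point e1 e2)"
    proof
      fix z assume z: "z \<in> L"
      obtain x y :: real where xy: "z = of_real x * e1 + of_real y * e2"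
        using real_coordinates[OF e2(2)] .
      define x' where "x' = x - of_int (round x)"
      define y' where "y' = y - of_int (round y)"
      have bd: "\<bar>x'\<bar> \<le> 1/2" "\<bar>y'\<bar> \<le> 1/2"
        using of_int_round_abs_le[of x] of_int_round_abs_le[of y] by (auto simp: x'_def y'_def abs_minus_commute)
      define z' where "z' = z - lattice_point e1 e2 (round x, round y)"
      have z': "z' = of_real x' * e1 + of_real y' * e2"
        by (simp add: z'_def xy lattice_point_def x'_def y'_def algebra_simps)
      have z'L: "z' \<in> L"
        unfolding z'_def lattice_point_def using add mult e1 e2 diff z by auto
      have "y' = 0"
      proof (rule ccontr)
        assume "y' \<noteq> 0"
        then have "Im (cnj e1 * z') \<noteq> 0" unfolding z' Im_cnj_combination using e2 by simp
        then have "norm e2 \<le> norm z'" using e2_min z'L by blast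
        then show False using norm_reduced[OF e2(2) le bd] unfolding z' by simp
      qed
      then have "norm z' = \<bar>x'\<bar> * norm e1" by (simp add: z' norm_mult)
      also have "\<dots> \<le> 1/2 * norm e1" using bd(1) by (rule mult_right_mono) simp
      also have "\<dots> < norm e1" using e1(2) by simp
      finally have "z' = 0" using e1_min[OF z'L] by fastforce
      then show "z \<in> range (lattice_point e1 e2)" unfolding z'_def by auto
    qed
  qed
  with e2(2) show thesis by (rule that)
qed

section \<open>Tessellations and their symmetries\<close>

text \<open>Three consecutive corners of a regular polygon are not collinear, since consecutive sides
  differ by the non-real factor \<open>\<omega>\<close>.\<close>

lemma regular_polygon_polytope:
  assumes "regular_polygon S"
  shows "polytope S" "aff_dim S = 2"
proof -
  obtain n :: nat and c w where n: "n \<ge> 3" and w: "w \<noteq> 0"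
    and S: "S = convex hull ((\<lambda>k. c + w * cis (2 * pi * real k / real n)) ` {..<n})"
    using assms unfolding regular_polygon_def by blast
  show "polytope S" unfolding S by (intro polytope_convex_hull) auto
  define \<omega> where "\<omega> = cis (2 * pi / real n)"
  have "Im \<omega> > 0"
    unfolding \<omega>_def using n by (auto simp: field_simps intro!: sin_gt_zero)
  have corner: "c + w * \<omega> ^ k \<in> S" if "k < n" for k
  proof -
    have "cis (2 * pi * real k / real n) = \<omega> ^ k"
      unfolding \<omega>_def Complex.DeMoivre by (rule arg_cong[of _ _ cis]) simp
    then show ?thesis unfolding S using that by (intro hull_inc) (force simp: image_iff)
  qed
  have "\<not> collinear S"
  proof
    assume "collinear S"
    then obtain u where u: "\<And>x y. x \<in> S \<Longrightarrow> y \<in> S \<Longrightarrow> \<exists>r. x - y = r *\<^sub>R u"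
      unfolding collinear_def by blast
    obtain r1 where r1: "(c + w * \<omega> ^ 1) - (c + w * \<omega> ^ 0) = r1 *\<^sub>R u"
      using u[OF corner[of 1] corner[of 0]] n by auto
    obtain r2 where r2: "(c + w * \<omega> ^ 2) - (c + w * \<omega> ^ 1) = r2 *\<^sub>R u"
      using u[OF corner[of 2] corner[of 1]] n by auto
    have ne: "w * (\<omega> - 1) \<noteq> 0" using w \<open>Im \<omega> > 0\<close> by auto
    have 1: "w * (\<omega> - 1) = of_real r1 * u"
      using r1 by (simp add: scaleR_conv_of_real algebra_simps)
    then have "r1 \<noteq> 0" "u \<noteq> 0" using ne by auto
    have "\<omega> * (w * (\<omega> - 1)) = of_real r2 * u"
      using r2 by (simp add: scaleR_conv_of_real algebra_simps power2_eq_square)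
    then have "\<omega> * of_real r1 * u = of_real r2 * u" unfolding 1 by (simp add: mult.assoc)
    then have "\<omega> * of_real r1 = of_real r2" using \<open>u \<noteq> 0\<close> by simp
    then have "Im (\<omega> * of_real r1) = 0" by simp
    then show False using \<open>r1 \<noteq> 0\<close> \<open>Im \<omega> > 0\<close> by simp
  qed
  then show "aff_dim S = 2"
    using aff_dim_le_DIM[of S] by (simp add: collinear_aff_dim)
qed

lemma image_split: "f ` S = (+) (f 0) ` linear_part f ` S"
  unfolding image_image linear_part_def by simp

lemma inj_linear_part: "isometry f \<Longrightarrow> inj (linear_part f)"
  using inj_isometry by (simp add: linear_part_def inj_def)

lemma isometry_edge_of: "isometry f \<Longrightarrow> f ` e edge_of f ` S \<longleftrightarrow> e edge_of S"
  unfolding edge_of_def image_split[of f]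
  by (simp add: face_of_linear_image linear_linear_part inj_linear_part aff_dim_translation_eq)

lemma isometry_face_of: "isometry f \<Longrightarrow> f ` e face_of f ` S \<longleftrightarrow> e face_of S"
  unfolding image_split[of f]
  by (simp add: face_of_linear_image linear_linear_part inj_linear_part)

lemma isometry_extreme_point_of: "isometry f \<Longrightarrow> f x extreme_point_of f ` S \<longleftrightarrow> x extreme_point_of S"
  using isometry_face_of[of f "{x}" S] by (simp add: face_of_singleton)

text \<open>An isometry that fixes two points is the identity or the reflection in their line. The second
  alternative is stated through midpoints, which is the form that convexity can use.\<close>

lemma isometry_fixing_segment:
  assumes f: "isometry f" "f a = a" "f b = b" and "a \<noteq> b"
  obtains "f = id" | "\<And>s. midpoint s (f s) \<in> affine hull {a, b}"
  using f(1)
proof (cases rule: isometry_cases)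
  case (rotation c d)
  have "c * (b - a) = f b - f a" by (simp add: rotation algebra_simps)
  then have "c * (b - a) = 1 * (b - a)" using f by simp
  then have "c = 1" using \<open>a \<noteq> b\<close> by (metis mult_right_cancel right_minus_eq)
  then have "f = id" using f(2) by (auto simp: rotation)
  then show ?thesis by (rule that)
next
  case (reflection c d)
  define u where "u = b - a"
  have u: "u \<noteq> 0" using \<open>a \<noteq> b\<close> by (simp add: u_def)
  have "c * cnj u = f b - f a" by (simp add: reflection u_def algebra_simps)
  then have cu: "c * cnj u = u" using f by (simp add: u_def)
  have "midpoint s (f s) \<in> affine hull {a, b}" for s
  proof -
    define k where "k = (s - a) / u"
    have s: "s = a + k * u" using u by (simp add: k_def)
    have "f s = a + cnj k * u"
    proof -
      have "f s = (c * cnj a + d) + cnj k * (c * cnj u)" by (simp add: s reflection algebra_simps)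
      also have "c * cnj a + d = a" using f(2) by (simp add: reflection)
      finally show ?thesis by (simp only: cu)
    qed
    then have "s + f s = 2 * a + (k + cnj k) * u" by (simp add: s algebra_simps)
    then have "s + f s = 2 *\<^sub>R (a + Re k *\<^sub>R (b - a))"
      by (simp add: complex_add_cnj scaleR_conv_of_real u_def[symmetric] algebra_simps)
    then have "midpoint s (f s) = a + Re k *\<^sub>R (b - a)" by (simp add: midpoint_def)
    then show ?thesis by (auto simp: affine_hull_2_alt)
  qed
  then show ?thesis by (rule that)
qed

text \<open>An isometry that fixes an endpoint of an edge and preserves the edge fixes both endpoints. Were it the
  reflection in the edge's line, a point of \<open>S\<close> off this line and its mirror image would have their
  midpoint in the line and in \<open>S\<close>, hence in the edge. But an edge is a face, so it contains both
  ends of any segment in \<open>S\<close> whose interior it meets.\<close>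

lemma isometry_fixing_flag:
  assumes f: "isometry f" "f v = v" "f ` e = e" "f ` S = S"
    and S: "polytope S" "aff_dim S = 2" and e: "e edge_of S" and v: "v extreme_point_of e"
  shows "f = id"
proof -
  have face: "e face_of S" and dim: "aff_dim e = 1" using e by (auto simp: edge_of_def)
  have "polytope e" using face_of_polytope_polytope[OF S(1) face] .
  moreover have "e \<noteq> {}" using dim by auto
  moreover have "collinear e" using dim by (simp add: collinear_aff_dim)
  ultimately obtain a b where ab: "e = closed_segment a b"
    using compact_convex_collinear_segment[OF _ polytope_imp_compact polytope_imp_convex]
    by blast
  have "a \<noteq> b" using dim ab by auto
  have ext: "x extreme_point_of e \<longleftrightarrow> x = a \<or> x = b" for x
    by (simp add: ab extreme_point_of_segment)
  have "f x extreme_point_of e \<longleftrightarrow> x extreme_point_of e" for x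
    using isometry_extreme_point_of[OF f(1), of x e] f(3) by simp
  then have "f a extreme_point_of e" "f b extreme_point_of e" using ext by blast+
  then have "f a = a \<or> f a = b" "f b = a \<or> f b = b" using ext by blast+
  moreover have "f a \<noteq> f b" using \<open>a \<noteq> b\<close> inj_isometry[OF f(1)] by (simp add: inj_eq)
  moreover have "v = a \<or> v = b" using v ext by simp
  ultimately have fab: "f a = a" "f b = b" using f(2) by auto
  show ?thesis
    using isometry_fixing_segment[OF f(1) fab \<open>a \<noteq> b\<close>]
  proof cases
    case 2
    have "s \<in> e" if s: "s \<in> S" for s
    proof -
      have fs: "f s \<in> S" using s f(4) by blast
      have "convex S" using S polytope_imp_convex by blast
      then have "midpoint s (f s) \<in> S"
        using s fs by (metis convex_contains_segment midpoint_in_closed_segment subsetD)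
      moreover have "midpoint s (f s) \<in> affine hull e"
        using 2[of s] by (simp add: ab segment_convex_hull)
      ultimately have m: "midpoint s (f s) \<in> e"
        using face_of_imp_eq_affine_Int[OF \<open>convex S\<close> face] by blast
      show ?thesis
      proof (cases "s = f s")
        case True
        then show ?thesis using m by (metis midpoint_idem)
      next
        case False
        then have "midpoint s (f s) \<in> open_segment s (f s)" by simp
        then show ?thesis using m s fs face unfolding face_of_def by blast
      qed
    qed
    then have "S = e" using face_of_imp_subset[OF face] by blast
    then show ?thesis using S dim by simp
  qed
qed

lemma symmetry_isometry: "f \<in> symmetries \<tau> \<Longrightarrow> isometry f"
  by (simp add: symmetries_def isometry_def)

lemma symmetry_bij: "f \<in> symmetries \<tau> \<Longrightarrow> bij f"
  using inj_isometry[OF symmetry_isometry] by (simp add: symmetries_def bij_def)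

lemma symmetry_face: "f \<in> symmetries \<tau> \<Longrightarrow> S \<in> \<tau> \<Longrightarrow> f ` S \<in> \<tau>"
  by (auto simp: symmetries_def)

lemma symmetry_id: "id \<in> symmetries \<tau>"
  by (simp add: symmetries_def)

lemma symmetry_comp:
  assumes "f \<in> symmetries \<tau>" "g \<in> symmetries \<tau>" shows "f \<circ> g \<in> symmetries \<tau>"
proof -
  have "(\<lambda>S. (f \<circ> g) ` S) ` \<tau> = (\<lambda>S. f ` S) ` (\<lambda>S. g ` S) ` \<tau>"
    by (simp add: image_image image_comp)
  moreover have "surj (f \<circ> g)" using assms comp_surj by (auto simp: symmetries_def)
  ultimately show ?thesis using assms by (simp add: symmetries_def comp_def)
qed

lemma symmetry_inv:
  assumes f: "f \<in> symmetries \<tau>" shows "inv_into UNIV f \<in> symmetries \<tau>"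
proof -
  let ?g = "inv_into UNIV f"
  have bij: "bij f" by (rule symmetry_bij[OF f])
  then have fg: "f (?g x) = x" and gf: "?g (f x) = x" for x
    by (simp_all add: bij_is_surj surj_f_inv_f bij_is_inj)
  have "dist (?g x) (?g y) = dist x y" for x y
    using f fg unfolding symmetries_def by (metis (mono_tags, lifting) mem_Collect_eq)
  moreover have "(\<lambda>S. ?g ` S) ` \<tau> = \<tau>"
  proof -
    have \<tau>: "\<tau> = (\<lambda>S. f ` S) ` \<tau>" using f by (simp add: symmetries_def)
    have "(\<lambda>S. ?g ` S) ` \<tau> = (\<lambda>S. ?g ` f ` S) ` \<tau>"
      by (subst \<tau>) (simp add: image_image)
    then show ?thesis by (simp add: image_image gf)
  qed
  ultimately show ?thesis
    using bij_imp_bij_inv[OF bij] by (simp add: symmetries_def bij_is_surj)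
qed

lemma symmetry_vertex:
  "f \<in> symmetries \<tau> \<Longrightarrow> v \<in> vertices \<tau> \<Longrightarrow> f v \<in> vertices \<tau>"
  unfolding vertices_def by (blast intro: symmetry_face isometry_extreme_point_of[THEN iffD2] symmetry_isometry)

lemma symmetry_edge:
  "f \<in> symmetries \<tau> \<Longrightarrow> e \<in> edges \<tau> \<Longrightarrow> f ` e \<in> edges \<tau>"
  unfolding edges_def by (blast intro: symmetry_face isometry_edge_of[THEN iffD2] symmetry_isometry)

lemma symmetry_flag:
  "f \<in> symmetries \<tau> \<Longrightarrow> x \<in> flags \<tau> \<Longrightarrow> flag_act f x \<in> flags \<tau>"
  by (auto simp: flags_def flag_act_def symmetry_face symmetry_edge symmetry_vertex)

lemma polytope_has_extreme_point:
  fixes S :: "complex set"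
  assumes "polytope S" "S \<noteq> {}"
  obtains v where "v extreme_point_of S"
  by (rule extreme_point_exists_convex[OF polytope_imp_compact polytope_imp_convex]) (use assms in auto)

locale tessellation =
  fixes \<tau> :: "complex set set"
  assumes tess: "polygonal_tessellation \<tau>"
begin

lemma polytope: "S \<in> \<tau> \<Longrightarrow> polytope S" and aff_dim: "S \<in> \<tau> \<Longrightarrow> aff_dim S = 2"
  using tess regular_polygon_polytope by (auto simp: polygonal_tessellation_def)

lemma cover: "\<exists>S\<in>\<tau>. x \<in> S"
  using tess by (auto simp: polygonal_tessellation_def)

lemma edge_to_edge:
  assumes "S \<in> \<tau>" "T \<in> \<tau>" "S \<noteq> T"
  obtains "S \<inter> T = {}"
  | v where "S \<inter> T = {v}" "v extreme_point_of S" "v extreme_point_of T"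
  | "S \<inter> T edge_of S" "S \<inter> T edge_of T"
proof -
  have "S \<inter> T = {} \<or> (\<exists>v. S \<inter> T = {v} \<and> v extreme_point_of S \<and> v extreme_point_of T) \<or>
      (S \<inter> T) edge_of S \<and> (S \<inter> T) edge_of T"
    using tess assms unfolding polygonal_tessellation_def by blast
  then show thesis using that by blast
qed

text \<open>In an edge-to-edge tessellation a corner of one tile is a corner of every tile that contains it;
  likewise for edges in \<open>edge_of_face\<close>. The flags as defined, with edges and vertices of possibly
  different tiles, are therefore flags of a single polygon.\<close>

lemma vertex_extreme:
  assumes "v \<in> vertices \<tau>" "S \<in> \<tau>" "v \<in> S"
  shows "v extreme_point_of S"
proof -
  obtain T where T: "T \<in> \<tau>" "v extreme_point_of T" using assms by (auto simp: vertices_def)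
  then have "v \<in> T" by (simp add: extreme_point_of_def)
  show ?thesis
  proof (cases "S = T")
    case False
    from assms(2) T(1) False show ?thesis
    proof (cases rule: edge_to_edge)
      case 3
      then have faces: "S \<inter> T face_of S" "S \<inter> T face_of T" by (simp_all add: edge_of_def)
      then have "v extreme_point_of S \<inter> T"
        using T(2) \<open>v \<in> T\<close> assms(3) extreme_point_of_face[OF faces(2)] by blast
      then show ?thesis using extreme_point_of_face[OF faces(1)] by blast
    next
      case (2 w)
      then have "v = w" using assms \<open>v \<in> T\<close> by blast
      then show ?thesis using 2 by simp
    qed (use assms \<open>v \<in> T\<close> in blast)
  qed (use T in simp)
qed

lemma edge_of_face:
  assumes "e \<in> edges \<tau>" "S \<in> \<tau>" "e \<subseteq> S"
  shows "e edge_of S"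
proof -
  obtain T where T: "T \<in> \<tau>" "e edge_of T" using assms by (auto simp: edges_def)
  then have face: "e face_of T" and dim: "aff_dim e = 1" and sub: "e \<subseteq> T"
    by (auto simp: edge_of_def face_of_imp_subset)
  show ?thesis
  proof (cases "S = T")
    case False
    from assms(2) T(1) False show ?thesis
    proof (cases rule: edge_to_edge)
      case 1
      then have "e = {}" using assms sub by blast
      then show ?thesis using dim by simp
    next
      case (2 v)
      then have "e \<subseteq> {v}" using assms sub by blast
      then show ?thesis using dim aff_dim_subset[of e "{v}"] by simp
    next
      case 3
      have "e face_of S \<inter> T"
        by (rule face_of_subset[OF face]) (use sub assms in auto)
      moreover have "convex (S \<inter> T)" using 3 by (simp add: edge_of_def face_of_imp_convex)
      ultimately have "e = S \<inter> T"
        using face_of_aff_dim_lt[of "S \<inter> T" e] 3 dim by (auto simp: edge_of_def)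
      then show ?thesis using 3 by simp
    qed
  qed (use T in simp)
qed

lemma flagD:
  assumes "(v, e, S) \<in> flags \<tau>"
  shows "S \<in> \<tau>" "e edge_of S" "v extreme_point_of S" "v extreme_point_of e"
proof -
  have *: "v \<in> vertices \<tau>" "e \<in> edges \<tau>" "S \<in> \<tau>" "v \<in> e" "e \<subseteq> S"
    using assms by (auto simp: flags_def)
  show "S \<in> \<tau>" "e edge_of S" "v extreme_point_of S"
    using * edge_of_face vertex_extreme by auto
  then show "v extreme_point_of e" using * extreme_point_of_face unfolding edge_of_def by blast
qed

lemma flag_fixed:
  assumes "f \<in> symmetries \<tau>" "x \<in> flags \<tau>" "flag_act f x = x"
  shows "f = id"
proof -
  obtain v e S where x: "x = (v, e, S)" by (cases x)
  have fl: "(v, e, S) \<in> flags \<tau>" using assms x by simp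
  have "f v = v" "f ` e = e" "f ` S = S" using assms by (simp_all add: x flag_act_def)
  then show ?thesis
    using isometry_fixing_flag[OF symmetry_isometry[OF assms(1)] _ _ _
        polytope[OF flagD(1)[OF fl]] aff_dim[OF flagD(1)[OF fl]] flagD(2)[OF fl] flagD(4)[OF fl]]
    by simp
qed

lemma flags_nonempty: "flags \<tau> \<noteq> {}"
proof -
  obtain S where S: "S \<in> \<tau>" using cover by blast
  have "0 < aff_dim S" using aff_dim[OF S] by simp
  then obtain e where "e facet_of S" by (rule polytope_facet_exists[OF polytope[OF S]])
  then have e: "e edge_of S" "e \<noteq> {}" using aff_dim S by (auto simp: facet_of_def edge_of_def)
  then have "polytope e" using polytope S face_of_polytope_polytope by (auto simp: edge_of_def)
  then obtain v where v: "v extreme_point_of e" using e(2) by (rule polytope_has_extreme_point)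
  then have "(v, e, S) \<in> flags \<tau>"
  proof -
    have face: "e face_of S" using e by (simp add: edge_of_def)
    then have "v extreme_point_of S" "v \<in> e" using v extreme_point_of_face by blast+
    then show ?thesis
      using S e face_of_imp_subset[OF face] unfolding flags_def vertices_def edges_def by blast
  qed
  then show ?thesis by blast
qed

lemma face_has_vertex:
  assumes "S \<in> \<tau>"
  obtains v where "v \<in> vertices \<tau>" "v \<in> S"
proof -
  have "S \<noteq> {}" using aff_dim[OF assms] by auto
  with polytope[OF assms] obtain v where "v extreme_point_of S" by (rule polytope_has_extreme_point)
  then show ?thesis using that assms by (auto simp: vertices_def extreme_point_of_def)
qed

lemma finite_faces_meeting: "finite {S \<in> \<tau>. S \<inter> cball 0 R \<noteq> {}}"
proof -
  have "\<forall>x. \<exists>r>0. finite {S \<in> \<tau>. S \<inter> ball x r \<noteq> {}}"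
    using tess by (simp add: polygonal_tessellation_def)
  then obtain r where r: "\<And>x. r x > 0" "\<And>x. finite {S \<in> \<tau>. S \<inter> ball x (r x) \<noteq> {}}"
    by metis
  obtain F where F: "F \<subseteq> cball 0 R" "finite F" "cball 0 R \<subseteq> (\<Union>x\<in>F. ball x (r x))"
  proof (rule compactE_image[OF compact_cball[of "0 :: complex" R]])
    show "cball 0 R \<subseteq> (\<Union>x\<in>cball 0 R. ball x (r x))" using r(1) by fastforce
  qed auto
  have "{S \<in> \<tau>. S \<inter> cball 0 R \<noteq> {}} \<subseteq> (\<Union>x\<in>F. {S \<in> \<tau>. S \<inter> ball x (r x) \<noteq> {}})"
  proof
    fix S assume "S \<in> {S \<in> \<tau>. S \<inter> cball 0 R \<noteq> {}}"
    then obtain y where y: "S \<in> \<tau>" "y \<in> S" "y \<in> cball 0 R" by blast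
    then obtain x where "x \<in> F" "y \<in> ball x (r x)" using F(3) by blast
    then show "S \<in> (\<Union>x\<in>F. {S \<in> \<tau>. S \<inter> ball x (r x) \<noteq> {}})" using y by blast
  qed
  then show ?thesis by (rule finite_subset) (use F r in auto)
qed

lemma finite_extreme_points:
  assumes "S \<in> \<tau>" shows "finite {v. v extreme_point_of S}"
proof -
  obtain F where F: "finite F" "S = convex hull F"
    using polytope[OF assms] unfolding polytope_def by blast
  then have "{v. v extreme_point_of S} \<subseteq> F" using extreme_point_of_convex_hull by blast
  then show ?thesis using F finite_subset by blast
qed

lemma finite_flags: "finite {(v, e, S) \<in> flags \<tau>. norm v \<le> R}"
proof -
  let ?F = "{S \<in> \<tau>. S \<inter> cball 0 R \<noteq> {}}"
  have "{(v, e, S) \<in> flags \<tau>. norm v \<le> R}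
      \<subseteq> (\<Union>S\<in>?F. {v. v extreme_point_of S} \<times> {e. e face_of S} \<times> {S})"
  proof clarify
    fix v e S assume fl: "(v, e, S) \<in> flags \<tau>" and "norm v \<le> R"
    have "v \<in> S" using flagD(3)[OF fl] by (simp add: extreme_point_of_def)
    then have "S \<in> ?F" using \<open>norm v \<le> R\<close> flagD(1)[OF fl] by auto
    moreover have "e face_of S" using flagD(2)[OF fl] by (simp add: edge_of_def)
    ultimately show "(v, e, S) \<in> (\<Union>S\<in>?F. {v. v extreme_point_of S} \<times> {e. e face_of S} \<times> {S})"
      using flagD(3)[OF fl] by blast
  qed
  moreover have "finite (\<Union>S\<in>?F. {v. v extreme_point_of S} \<times> {e. e face_of S} \<times> {S})"
    by (intro finite_UN_I finite_cartesian_product finite_faces_meeting)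
      (use finite_extreme_points finite_polytope_faces polytope in auto)
  ultimately show ?thesis by (rule finite_subset)
qed

lemma finite_vertices: "finite (vertices \<tau> \<inter> cball 0 R)"
proof -
  let ?F = "{S \<in> \<tau>. S \<inter> cball 0 R \<noteq> {}}"
  have "vertices \<tau> \<inter> cball 0 R \<subseteq> (\<Union>S\<in>?F. {v. v extreme_point_of S})"
    by (auto simp: vertices_def extreme_point_of_def)
  moreover have "finite (\<Union>S\<in>?F. {v. v extreme_point_of S})"
    using finite_faces_meeting finite_extreme_points by auto
  ultimately show ?thesis by (rule finite_subset)
qed

end

locale archimedean_tessellation =
  fixes \<tau> :: "complex set set"
  assumes archimedean: "archimedean \<tau>"
begin

sublocale tessellation
  using archimedean by unfold_locales (simp add: archimedean_def)

lemma transitive: "v \<in> vertices \<tau> \<Longrightarrow> w \<in> vertices \<tau> \<Longrightarrow> \<exists>f\<in>symmetries \<tau>. f v = w"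
  using archimedean by (simp add: archimedean_def)

text \<open>Every tile has a corner, which a symmetry moves to a fixed vertex \<open>v\<close>. So every tile is congruent to one
  of the finitely many tiles at \<open>v\<close>, and the diameters of the tiles are bounded.\<close>

lemma orbit_dense: "\<exists>v D. v \<in> vertices \<tau> \<and> (\<forall>x. \<exists>f\<in>symmetries \<tau>. dist x (f v) \<le> D)"
proof -
  obtain v where v: "v \<in> vertices \<tau>" using face_has_vertex cover by metis
  let ?F = "{S \<in> \<tau>. v \<in> S}"
  have "?F \<subseteq> {S \<in> \<tau>. S \<inter> cball 0 (norm v) \<noteq> {}}" by auto
  then have "finite ?F" using finite_faces_meeting finite_subset by blast
  then have "bounded (\<Union>?F)"
    using polytope polytope_imp_compact compact_imp_bounded by (intro bounded_Union) auto
  then obtain D where D: "\<And>y. y \<in> \<Union>?F \<Longrightarrow> dist v y \<le> D"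
    by (auto simp: bounded_any_center[of _ v])
  have "\<exists>f\<in>symmetries \<tau>. dist x (f v) \<le> D" for x
  proof -
    obtain S where S: "S \<in> \<tau>" "x \<in> S" using cover by blast
    obtain w where w: "w \<in> vertices \<tau>" "w \<in> S" using face_has_vertex S by blast
    obtain f where f: "f \<in> symmetries \<tau>" "f v = w" using transitive v w by blast
    let ?g = "inv_into UNIV f"
    have g: "?g \<in> symmetries \<tau>" using symmetry_inv f by blast
    have "?g w = v" using f symmetry_bij by (metis bij_inv_eq_iff)
    then have "?g x \<in> \<Union>?F" using symmetry_face[OF g S(1)] S w by blast
    then have "dist (?g w) (?g x) \<le> D" using D \<open>?g w = v\<close> by simp
    then have "dist x (f v) \<le> D"
      using symmetry_isometry[OF g] f by (simp add: isometry_def dist_commute)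
    then show ?thesis using f by blast
  qed
  then show ?thesis using v by blast
qed

definition \<Lambda> where "\<Lambda> = {t. (+) t \<in> symmetries \<tau>}"

lemma translation_diff: "x \<in> \<Lambda> \<Longrightarrow> y \<in> \<Lambda> \<Longrightarrow> x - y \<in> \<Lambda>"
proof -
  assume *: "x \<in> \<Lambda>" "y \<in> \<Lambda>"
  have "inv_into UNIV ((+) y) = (\<lambda>z. z - y)" by (rule inv_unique_comp) auto
  then have "(+) x \<circ> (\<lambda>z. z - y) \<in> symmetries \<tau>"
    using * symmetry_comp symmetry_inv unfolding \<Lambda>_def by (metis mem_Collect_eq)
  moreover have "(+) x \<circ> (\<lambda>z. z - y) = (+) (x - y)" by auto
  ultimately show ?thesis by (simp add: \<Lambda>_def)
qed

lemma finite_translations: "finite (\<Lambda> \<inter> cball 0 R)"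
proof -
  obtain v where v: "v \<in> vertices \<tau>" using orbit_dense by blast
  have "(\<lambda>t. t + v) ` (\<Lambda> \<inter> cball 0 R) \<subseteq> vertices \<tau> \<inter> cball 0 (R + norm v)"
    using symmetry_vertex[OF _ v] by (auto simp: \<Lambda>_def intro: norm_triangle_mono)
  then have "finite ((\<lambda>t. t + v) ` (\<Lambda> \<inter> cball 0 R))"
    using finite_vertices finite_subset by blast
  then show ?thesis by (rule finite_imageD) (auto simp: inj_on_def)
qed

lemma translation_lattice_basis:
  obtains e1 e2 where "Im (cnj e1 * e2) \<noteq> 0" "\<Lambda> = range (lattice_point e1 e2)"
proof -
  obtain v D where dense: "\<And>x. \<exists>f\<in>symmetries \<tau>. dist x (f v) \<le> D" using orbit_dense by blast
  have "\<exists>s t. (+) s \<in> symmetries \<tau> \<and> (+) t \<in> symmetries \<tau> \<and> Im (cnj s * t) \<noteq> 0"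
    by (rule two_independent_translations[where v = v and D = D])
      (use symmetry_isometry symmetry_comp symmetry_inv dense in blast)+
  then obtain s t where st: "s \<in> \<Lambda>" "t \<in> \<Lambda>" "Im (cnj s * t) \<noteq> 0" unfolding \<Lambda>_def by blast
  show thesis
    by (rule discrete_subgroup_basis[OF translation_diff finite_translations st that])
qed

end

section \<open>Groups of translations and their normalizers\<close>

lemma group_Aut: "group (Aut \<tau>)"
proof (rule groupI)
  fix f assume "f \<in> carrier (Aut \<tau>)"
  then have f: "f \<in> symmetries \<tau>" by (simp add: Aut_def)
  have "inv_into UNIV f \<circ> f = id" using symmetry_bij[OF f] by (simp add: bij_is_inj)
  then show "\<exists>g\<in>carrier (Aut \<tau>). g \<otimes>\<^bsub>Aut \<tau>\<^esub> f = \<one>\<^bsub>Aut \<tau>\<^esub>"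
    using symmetry_inv[OF f] by (auto simp: Aut_def)
qed (auto simp: Aut_def symmetry_id symmetry_comp comp_assoc)

lemma inv_Aut:
  assumes f: "f \<in> symmetries \<tau>"
  shows "inv\<^bsub>Aut \<tau>\<^esub> f = inv_into UNIV f"
proof (rule group.inv_equality[OF group_Aut])
  show "inv_into UNIV f \<otimes>\<^bsub>Aut \<tau>\<^esub> f = \<one>\<^bsub>Aut \<tau>\<^esub>"
    using symmetry_bij[OF f] by (simp add: Aut_def bij_is_inj)
qed (use f symmetry_inv in \<open>auto simp: Aut_def\<close>)

lemma inv_translation: "inv_into UNIV ((+) t) = (+) (- t :: complex)"
  by (rule inv_unique_comp) auto

lemma comp_translation: "(+) s \<circ> (+) t = (+) (s + t :: complex)"
  by auto

lemma translation_inj: "(+) s = (+) (t :: complex) \<longleftrightarrow> s = t"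
  by (metis add.right_neutral)

lemma translation_image_subset: "(+) ` A \<subseteq> (+) ` (B :: complex set) \<longleftrightarrow> A \<subseteq> B"
  using translation_inj by (auto simp: image_iff subset_iff)

lemma translation_group_eq:
  assumes u: "(+) u \<in> symmetries \<tau>" and v: "(+) v \<in> symmetries \<tau>"
  shows "translation_group \<tau> u v = (+) ` range (lattice_point u v)"
proof
  let ?G = "generate (Aut \<tau>) {(+) u, (+) v}"
  show "translation_group \<tau> u v \<subseteq> (+) ` range (lattice_point u v)"
  proof
    fix f assume "f \<in> translation_group \<tau> u v"
    then have "f \<in> ?G" by (simp add: translation_group_def)
    then have "\<exists>i j. f = (+) (lattice_point u v (i, j))"
    proof induction
      case one
      have "\<one>\<^bsub>Aut \<tau>\<^esub> = (+) (lattice_point u v (0, 0))" by (auto simp: Aut_def lattice_point_def)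
      then show ?case by blast
    next
      case (incl h)
      have "(+) u = (+) (lattice_point u v (1, 0))" "(+) v = (+) (lattice_point u v (0, 1))"
        by (auto simp: lattice_point_def)
      then show ?case using incl by blast
    next
      case (inv h)
      have "inv\<^bsub>Aut \<tau>\<^esub> ((+) u) = (+) (lattice_point u v (-1, 0))"
        "inv\<^bsub>Aut \<tau>\<^esub> ((+) v) = (+) (lattice_point u v (0, -1))"
        using u v by (simp_all add: inv_Aut inv_translation lattice_point_def)
      then show ?case using inv by blast
    next
      case (eng f g)
      then obtain i j k l where "f = (+) (lattice_point u v (i, j))" "g = (+) (lattice_point u v (k, l))"
        by blast
      then have "f \<otimes>\<^bsub>Aut \<tau>\<^esub> g = (+) (lattice_point u v (i + k, j + l))"
        by (simp add: Aut_def comp_translation lattice_point_add)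
      then show ?case by blast
    qed
    then show "f \<in> (+) ` range (lattice_point u v)" by blast
  qed
  have eng: "(+) (s + t) \<in> ?G" if "(+) s \<in> ?G" "(+) t \<in> ?G" for s t
    using generate.eng[OF that] by (simp add: Aut_def comp_translation)
  have mult: "(+) (of_int m * w) \<in> ?G" if w: "w = u \<or> w = v" for m w
  proof -
    have "(+) w \<in> ?G" "(+) (- w) \<in> ?G"
      using w u v generate.incl[of "(+) w" "{(+) u, (+) v}" "Aut \<tau>"]
        generate.inv[of "(+) w" "{(+) u, (+) v}" "Aut \<tau>"]
      by (auto simp: inv_Aut inv_translation)
    note step = eng[OF _ this(1)] eng[OF _ this(2)]
    show ?thesis
    proof (induction m rule: int_induct[where k = 0])
      case base
      have eq: "(+) (of_int 0 * w) = \<one>\<^bsub>Aut \<tau>\<^esub>" by (auto simp: Aut_def)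
      show ?case unfolding eq by (rule generate.one)
    next
      case (step1 i)
      have eq: "of_int (i + 1) * w = of_int i * w + w" by (simp add: algebra_simps)
      show ?case unfolding eq by (rule step(1)[OF step1(2)])
    next
      case (step2 i)
      have eq: "of_int (i - 1) * w = of_int i * w + - w" by (simp add: algebra_simps)
      show ?case unfolding eq by (rule step(2)[OF step2(2)])
    qed
  qed
  show "(+) ` range (lattice_point u v) \<subseteq> translation_group \<tau> u v"
    unfolding translation_group_def lattice_point_def using eng mult by blast
qed

lemma conj_translation:
  assumes f: "f \<in> symmetries \<tau>"
  shows "(f \<circ> (+) t) \<circ> inv_into UNIV f = (+) (linear_part f t)"
proof
  fix x
  have "f (t + inv_into UNIV f x) = f (inv_into UNIV f x) + linear_part f t"
    using isometry_add[OF symmetry_isometry[OF f], of "inv_into UNIV f x" t] by (simp add: add.commute)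
  also have "f (inv_into UNIV f x) = x"
    using symmetry_bij[OF f] by (simp add: bij_is_surj surj_f_inv_f)
  finally show "((f \<circ> (+) t) \<circ> inv_into UNIV f) x = linear_part f t + x" by simp
qed

lemma translation_past_symmetry:
  assumes f: "f \<in> symmetries \<tau>"
  shows "f \<circ> (+) t = (+) (linear_part f t) \<circ> f"
  using isometry_add[OF symmetry_isometry[OF f]] by (auto simp: add.commute)

lemma normalizer_translations:
  assumes L: "(+) ` L \<subseteq> symmetries \<tau>"
  shows "normalizer (Aut \<tau>) ((+) ` L) = {f \<in> symmetries \<tau>. linear_part f ` L = L}"
proof -
  have conj: "f <#\<^bsub>Aut \<tau>\<^esub> ((+) ` L) #>\<^bsub>Aut \<tau>\<^esub> (inv\<^bsub>Aut \<tau>\<^esub> f) = (+) ` linear_part f ` L"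
    if f: "f \<in> symmetries \<tau>" for f
  proof -
    have "f <#\<^bsub>Aut \<tau>\<^esub> ((+) ` L) #>\<^bsub>Aut \<tau>\<^esub> (inv\<^bsub>Aut \<tau>\<^esub> f)
        = (\<lambda>t. (f \<circ> (+) t) \<circ> inv_into UNIV f) ` L"
      unfolding l_coset_def r_coset_def inv_Aut[OF f] by (auto simp: Aut_def)
    then show ?thesis unfolding conj_translation[OF f] by (simp add: image_image)
  qed
  have eq: "(+) ` A = (+) ` B \<longleftrightarrow> A = B" for A B :: "complex set"
    using translation_image_subset by (metis subset_antisym subset_refl)
  have carrier: "carrier (Aut \<tau>) = symmetries \<tau>" by (simp add: Aut_def)
  show ?thesis
    unfolding normalizer_def stabilizer_def carrier
    by (simp add: L conj eq cong: conj_cong)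
qed

lemma linear_part_inv:
  assumes f: "f \<in> symmetries \<tau>"
  shows "linear_part f (linear_part (inv_into UNIV f) t) = t"
proof -
  have "f \<circ> inv_into UNIV f = id" using symmetry_bij[OF f] by (simp add: bij_is_surj surj_iff[symmetric])
  then show ?thesis
    using linear_part_comp[OF symmetry_isometry[OF f], of "inv_into UNIV f" t]
    by (simp add: linear_part_def)
qed

lemma linear_part_inv':
  assumes f: "f \<in> symmetries \<tau>"
  shows "linear_part (inv_into UNIV f) (linear_part f t) = t"
proof -
  have "inv_into UNIV f \<circ> f = id" using symmetry_bij[OF f] by (simp add: bij_is_inj)
  then show ?thesis
    using linear_part_comp[OF symmetry_isometry[OF symmetry_inv[OF f]], of f t]
    by (simp add: linear_part_def)
qed

lemma invariant_iff:
  "(\<forall>f\<in>symmetries \<tau>. linear_part f ` L = L) \<longleftrightarrow> (\<forall>f\<in>symmetries \<tau>. \<forall>t\<in>L. linear_part f t \<in> L)"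
proof
  assume inv: "\<forall>f\<in>symmetries \<tau>. \<forall>t\<in>L. linear_part f t \<in> L"
  show "\<forall>f\<in>symmetries \<tau>. linear_part f ` L = L"
  proof
    fix f assume f: "f \<in> symmetries \<tau>"
    have "t \<in> linear_part f ` L" if "t \<in> L" for t
      using inv symmetry_inv[OF f] that linear_part_inv[OF f, of t] by (metis imageI)
    then show "linear_part f ` L = L" using inv f by blast
  qed
qed blast

section \<open>Almost regular maps\<close>

lemma flag_act_comp: "flag_act (f \<circ> g) x = flag_act f (flag_act g x)"
  by (cases x) (auto simp: flag_act_def image_comp)

lemma flag_act_id: "flag_act id x = x"
  by (cases x) (auto simp: flag_act_def)

definition flag_orbit :: "(complex \<Rightarrow> complex) set \<Rightarrow> flag \<Rightarrow> flag set" where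
  "flag_orbit N x = (\<lambda>f. flag_act f x) ` N"

definition symmetry_subgroup :: "complex set set \<Rightarrow> (complex \<Rightarrow> complex) set \<Rightarrow> bool" where
  "symmetry_subgroup \<tau> N \<longleftrightarrow> N \<subseteq> symmetries \<tau> \<and> id \<in> N \<and> (\<forall>f\<in>N. \<forall>g\<in>N. f \<circ> g \<in> N) \<and>
     (\<forall>f\<in>N. inv_into UNIV f \<in> N)"

lemma symmetry_subgroup_symmetries: "symmetry_subgroup \<tau> (symmetries \<tau>)"
  by (simp add: symmetry_subgroup_def symmetry_id symmetry_comp symmetry_inv)

lemma flag_act_inv:
  assumes "f \<in> symmetries \<tau>"
  shows "flag_act (inv_into UNIV f) (flag_act f x) = x"
proof -
  have "inv_into UNIV f \<circ> f = id" using symmetry_bij[OF assms] by (simp add: bij_is_inj)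
  then show ?thesis by (metis flag_act_comp flag_act_id)
qed

lemma flag_orbit_refl: "symmetry_subgroup \<tau> N \<Longrightarrow> x \<in> flag_orbit N x"
  unfolding flag_orbit_def symmetry_subgroup_def by (metis flag_act_id imageI)

lemma flag_orbit_act:
  assumes N: "symmetry_subgroup \<tau> N" and f: "f \<in> N"
  shows "flag_orbit N (flag_act f x) = flag_orbit N x"
proof
  show "flag_orbit N (flag_act f x) \<subseteq> flag_orbit N x"
    using N f unfolding flag_orbit_def symmetry_subgroup_def by (auto simp flip: flag_act_comp)
  show "flag_orbit N x \<subseteq> flag_orbit N (flag_act f x)"
  proof
    fix y assume "y \<in> flag_orbit N x"
    then obtain g where g: "g \<in> N" "y = flag_act g x" by (auto simp: flag_orbit_def)
    have "y = flag_act (g \<circ> inv_into UNIV f) (flag_act f x)"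
      using N f g flag_act_inv[of f \<tau> x] by (auto simp: flag_act_comp symmetry_subgroup_def)
    moreover have "g \<circ> inv_into UNIV f \<in> N" using N f g by (auto simp: symmetry_subgroup_def)
    ultimately show "y \<in> flag_orbit N (flag_act f x)" by (auto simp: flag_orbit_def)
  qed
qed

lemma orbits_eq_image: "orbits G E \<phi> = orbit G \<phi> ` E"
  unfolding orbits_def by blast

lemma orbit_eq_image: "orbit G \<phi> x = (\<lambda>g. \<phi> g x) ` carrier G"
  unfolding orbit_def by blast

text \<open>Each orbit of the full group is a union of orbits of \<open>N\<close>. If the two numbers of orbits agree and are
  finite, each orbit of the full group is a single orbit of \<open>N\<close>; then any symmetry agrees with some
  element of \<open>N\<close> on one flag, and so is equal to it because flags have trivial stabilizers.\<close>

lemma (in tessellation) flag_orbit_count_eq_iff: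
  assumes N: "symmetry_subgroup \<tau> N" and fin: "finite (flag_orbit N ` flags \<tau>)"
  shows "card (flag_orbit N ` flags \<tau>) = card (flag_orbit (symmetries \<tau>) ` flags \<tau>)
         \<longleftrightarrow> N = symmetries \<tau>"
proof
  let ?A = "symmetries \<tau>"
  let ?merge = "\<lambda>X. \<Union>f\<in>?A. flag_act f ` X"
  assume eq: "card (flag_orbit N ` flags \<tau>) = card (flag_orbit ?A ` flags \<tau>)"
  have A: "symmetry_subgroup \<tau> ?A" by (rule symmetry_subgroup_symmetries)
  have merge: "?merge (flag_orbit N x) = flag_orbit ?A x" for x
  proof
    show "?merge (flag_orbit N x) \<subseteq> flag_orbit ?A x"
      using N symmetry_comp unfolding flag_orbit_def symmetry_subgroup_def
      by (auto simp flip: flag_act_comp)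
    show "flag_orbit ?A x \<subseteq> ?merge (flag_orbit N x)"
      using flag_orbit_refl[OF N, of x] by (auto simp: flag_orbit_def)
  qed
  then have "?merge ` flag_orbit N ` flags \<tau> = flag_orbit ?A ` flags \<tau>"
    by (simp add: image_image)
  then have inj: "inj_on ?merge (flag_orbit N ` flags \<tau>)"
    using eq fin by (metis (no_types, lifting) eq_card_imp_inj_on)
  have "f \<in> N" if f: "f \<in> ?A" for f
  proof -
    obtain x where x: "x \<in> flags \<tau>" using flags_nonempty by blast
    have fx: "flag_act f x \<in> flags \<tau>" using symmetry_flag f x by blast
    have "?merge (flag_orbit N (flag_act f x)) = ?merge (flag_orbit N x)"
      unfolding merge by (rule flag_orbit_act[OF A f])
    then have "flag_orbit N (flag_act f x) = flag_orbit N x"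
      by (rule inj_onD[OF inj]) (use x fx in auto)
    then have "flag_act f x \<in> flag_orbit N x" using flag_orbit_refl[OF N] by metis
    then obtain g where g: "g \<in> N" "flag_act f x = flag_act g x" by (auto simp: flag_orbit_def)
    have gA: "g \<in> ?A" using g N by (auto simp: symmetry_subgroup_def)
    have "flag_act (inv_into UNIV g \<circ> f) x = x"
      using g flag_act_inv[OF gA] by (simp add: flag_act_comp)
    then have id: "inv_into UNIV g \<circ> f = id"
      using flag_fixed x f gA symmetry_comp symmetry_inv by blast
    have "f y = g y" for y
      using fun_cong[OF id, of y] symmetry_bij[OF gA] by (metis bij_inv_eq_iff comp_apply id_apply)
    then have "f = g" by blast
    then show ?thesis using g by simp
  qed
  then show "N = ?A" using N by (auto simp: symmetry_subgroup_def)
qed simp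

text \<open>A fundamental parallelogram of the lattice meets only finitely many flags, so a toroidal map has
  finitely many of them. Infinite sets have \<open>card\<close> equal to \<open>0\<close>, so counting flag orbits needs this.\<close>

lemma translate_near_origin:
  assumes "Im (cnj u * v) \<noteq> 0"
  obtains t where "t \<in> range (lattice_point u v)" "norm (t + z) \<le> norm u + norm v"
proof -
  obtain x y :: real where z: "z = of_real x * u + of_real y * v" using real_coordinates[OF assms] .
  let ?t = "lattice_point u v (- \<lfloor>x\<rfloor>, - \<lfloor>y\<rfloor>)"
  have "?t + z = of_real (frac x) * u + of_real (frac y) * v"
    by (simp add: z lattice_point_def frac_def algebra_simps)
  also have "norm \<dots> \<le> frac x * norm u + frac y * norm v"
    by (rule order_trans[OF norm_triangle_ineq]) (simp add: norm_mult)
  also have "\<dots> \<le> 1 * norm u + 1 * norm v"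
    by (intro add_mono mult_right_mono) (auto simp: less_imp_le[OF frac_lt_1])
  finally show thesis using that[of ?t] by simp
qed

text \<open>A flag orbit of the quotient map under its automorphism group consists of the \<open>H\<close>-orbits contained in
  one orbit of the normalizer on the flags of \<open>\<tau>\<close>, where \<open>H\<close> is the group of translations by \<open>L\<close>.\<close>

lemma map_orbits_eq:
  assumes L: "(+) ` L \<subseteq> symmetries \<tau>" "0 \<in> L" "\<And>s t. s \<in> L \<Longrightarrow> t \<in> L \<Longrightarrow> s + t \<in> L"
  defines "N \<equiv> {f \<in> symmetries \<tau>. linear_part f ` L = L}"
  shows "orbits (map_Aut \<tau> ((+) ` L)) (map_flags \<tau> ((+) ` L)) map_flag_act
       = (\<lambda>X. flag_orbit ((+) ` L) ` X) ` flag_orbit N ` flags \<tau>"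
proof -
  let ?H = "(+) ` L"
  have N: "normalizer (Aut \<tau>) ?H = N"
    unfolding N_def by (rule normalizer_translations[OF L(1)])
  have flags: "map_flags \<tau> ?H = flag_orbit ?H ` flags \<tau>"
    by (simp add: map_flags_def orbits_eq_image orbit_eq_image flag_orbit_def)
  have carrier: "carrier (map_Aut \<tau> ?H) = (\<lambda>a. (\<lambda>t. (+) t \<circ> a) ` L) ` N"
    unfolding map_Aut_def N FactGroup_def RCOSETS_def r_coset_def by (auto simp: Aut_def)
  have act: "map_flag_act ((\<lambda>t. (+) t \<circ> a) ` L) (flag_orbit ?H x) = flag_orbit ?H (flag_act a x)"
    if a: "a \<in> N" for a x
  proof
    have aS: "a \<in> symmetries \<tau>" and aL: "linear_part a ` L = L" using a by (auto simp: N_def)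
    show "map_flag_act ((\<lambda>t. (+) t \<circ> a) ` L) (flag_orbit ?H x) \<subseteq> flag_orbit ?H (flag_act a x)"
    proof
      fix y assume "y \<in> map_flag_act ((\<lambda>t. (+) t \<circ> a) ` L) (flag_orbit ?H x)"
      then obtain s t where st: "s \<in> L" "t \<in> L" "y = flag_act ((+) s \<circ> a) (flag_act ((+) t) x)"
        by (auto simp: map_flag_act_def flag_orbit_def)
      have "y = flag_act ((+) s \<circ> (a \<circ> (+) t)) x"
        unfolding st(3) flag_act_comp ..
      also have "\<dots> = flag_act (((+) s \<circ> (+) (linear_part a t)) \<circ> a) x"
        by (simp only: translation_past_symmetry[OF aS] comp_assoc)
      also have "\<dots> = flag_act ((+) (s + linear_part a t)) (flag_act a x)"
        unfolding comp_translation flag_act_comp ..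
      finally have "y = flag_act ((+) (s + linear_part a t)) (flag_act a x)" .
      moreover have "s + linear_part a t \<in> L" using L(3) st aL by blast
      ultimately show "y \<in> flag_orbit ?H (flag_act a x)" by (auto simp: flag_orbit_def)
    qed
    show "flag_orbit ?H (flag_act a x) \<subseteq> map_flag_act ((\<lambda>t. (+) t \<circ> a) ` L) (flag_orbit ?H x)"
    proof
      fix y assume "y \<in> flag_orbit ?H (flag_act a x)"
      then obtain t where t: "t \<in> L" "y = flag_act ((+) t \<circ> a) x"
        by (auto simp: flag_orbit_def flag_act_comp)
      have "(+) (0 :: complex) = id" by auto
      then have "x \<in> flag_orbit ?H x" using L(2) flag_act_id unfolding flag_orbit_def by (metis imageI)
      then show "y \<in> map_flag_act ((\<lambda>t. (+) t \<circ> a) ` L) (flag_orbit ?H x)"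
        using t by (auto simp: map_flag_act_def)
    qed
  qed
  have "orbit (map_Aut \<tau> ?H) map_flag_act (flag_orbit ?H x) = flag_orbit ?H ` flag_orbit N x" for x
  proof -
    have "orbit (map_Aut \<tau> ?H) map_flag_act (flag_orbit ?H x)
        = (\<lambda>a. map_flag_act ((\<lambda>t. (+) t \<circ> a) ` L) (flag_orbit ?H x)) ` N"
      unfolding orbit_eq_image carrier image_image ..
    also have "\<dots> = (\<lambda>a. flag_orbit ?H (flag_act a x)) ` N"
      using act by (intro image_cong) auto
    finally show ?thesis by (simp add: flag_orbit_def[of N] image_image)
  qed
  then show ?thesis unfolding orbits_eq_image flags by (simp add: image_image)
qed

lemma symmetry_subgroup_stabilizer:
  "symmetry_subgroup \<tau> {f \<in> symmetries \<tau>. linear_part f ` L = L}"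
proof -
  have "linear_part id ` L = L" by (simp add: linear_part_def)
  moreover have "linear_part (f \<circ> g) ` L = L"
    if "f \<in> symmetries \<tau>" "linear_part f ` L = L" "linear_part g ` L = L" for f g
    using that linear_part_comp[OF symmetry_isometry, of f \<tau> g]
    by (metis (no_types, lifting) image_cong image_image)
  moreover have "linear_part (inv_into UNIV f) ` L = L"
    if "f \<in> symmetries \<tau>" "linear_part f ` L = L" for f
  proof -
    have "linear_part (inv_into UNIV f) ` linear_part f ` L = L"
      by (simp add: image_image linear_part_inv'[OF that(1)])
    then show ?thesis using that by simp
  qed
  ultimately show ?thesis
    by (simp add: symmetry_subgroup_def symmetry_id symmetry_comp symmetry_inv)
qed

lemma (in tessellation) almost_regular_iff:
  assumes ind: "Im (cnj u * v) \<noteq> 0"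
  defines "L \<equiv> range (lattice_point u v)"
  assumes L: "(+) ` L \<subseteq> symmetries \<tau>"
  shows "almost_regular \<tau> ((+) ` L) \<longleftrightarrow> (\<forall>f\<in>symmetries \<tau>. \<forall>t\<in>L. linear_part f t \<in> L)"
proof -
  let ?H = "(+) ` L"
  define N where "N = {f \<in> symmetries \<tau>. linear_part f ` L = L}"
  have N: "symmetry_subgroup \<tau> N" unfolding N_def by (rule symmetry_subgroup_stabilizer)
  have zero: "0 \<in> L" unfolding L_def by (rule range_eqI[of _ _ "(0, 0)"]) (simp add: lattice_point_def)
  have add: "s + t \<in> L" if st: "s \<in> L" "t \<in> L" for s t
  proof -
    obtain p q where "s = lattice_point u v p" "t = lattice_point u v q"
      using st unfolding L_def by blast
    then have "s + t = lattice_point u v (fst p + fst q, snd p + snd q)"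
      by (simp add: lattice_point_add)
    then show ?thesis unfolding L_def by blast
  qed
  have HN: "?H \<subseteq> N"
  proof -
    have "linear_part ((+) t) ` L = L" for t :: complex by (simp add: linear_part_def)
    then show ?thesis using L unfolding N_def by blast
  qed
  have merge: "\<Union> (flag_orbit ?H ` flag_orbit N x) = flag_orbit N x" for x
  proof
    show "\<Union> (flag_orbit ?H ` flag_orbit N x) \<subseteq> flag_orbit N x"
    proof
      fix z assume "z \<in> \<Union> (flag_orbit ?H ` flag_orbit N x)"
      then obtain h f where "h \<in> ?H" "f \<in> N" "z = flag_act (h \<circ> f) x"
        unfolding flag_orbit_def flag_act_comp by blast
      moreover then have "h \<circ> f \<in> N" using HN N unfolding symmetry_subgroup_def by blast
      ultimately show "z \<in> flag_orbit N x" unfolding flag_orbit_def by blast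
    qed
    have "(+) (0 :: complex) = id" by auto
    then have "y \<in> flag_orbit ?H y" for y
      using zero flag_act_id unfolding flag_orbit_def by (metis imageI)
    then show "flag_orbit N x \<subseteq> \<Union> (flag_orbit ?H ` flag_orbit N x)" by blast
  qed
  have inj: "inj_on (\<lambda>X. flag_orbit ?H ` X) (flag_orbit N ` flags \<tau>)"
  proof (rule inj_on_inverseI)
    fix X assume "X \<in> flag_orbit N ` flags \<tau>"
    then obtain x where "X = flag_orbit N x" by blast
    then show "\<Union> (flag_orbit ?H ` X) = X" by (simp only: merge)
  qed
  have orbs: "orbits (map_Aut \<tau> ?H) (map_flags \<tau> ?H) map_flag_act
      = (\<lambda>X. flag_orbit ?H ` X) ` flag_orbit N ` flags \<tau>"
    unfolding N_def by (rule map_orbits_eq[OF L zero add])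
  have card1: "card (orbits (map_Aut \<tau> ?H) (map_flags \<tau> ?H) map_flag_act)
      = card (flag_orbit N ` flags \<tau>)"
    unfolding orbs by (rule card_image[OF inj])
  have card2: "orbits (Aut \<tau>) (flags \<tau>) flag_act = flag_orbit (symmetries \<tau>) ` flags \<tau>"
    by (simp add: orbits_eq_image orbit_eq_image flag_orbit_def Aut_def)
  let ?R = "norm u + norm v"
  have "flag_orbit N ` flags \<tau> \<subseteq> flag_orbit N ` {(v, e, S) \<in> flags \<tau>. norm v \<le> ?R}"
  proof
    fix X assume "X \<in> flag_orbit N ` flags \<tau>"
    then obtain x0 where "x0 \<in> flags \<tau>" "X = flag_orbit N x0" by blast
    moreover obtain w e S where "x0 = (w, e, S)" by (cases x0)
    ultimately have x: "(w, e, S) \<in> flags \<tau>" "X = flag_orbit N (w, e, S)" by simp_all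
    obtain t where t: "t \<in> L" "norm (t + w) \<le> ?R"
      unfolding L_def using translate_near_origin[OF ind] .
    let ?y = "flag_act ((+) t) (w, e, S)"
    have "(+) t \<in> N" using t HN by blast
    then have "X = flag_orbit N ?y" unfolding x(2) by (rule flag_orbit_act[OF N, symmetric])
    moreover have "(+) t \<in> symmetries \<tau>" using t L by blast
    then have "?y \<in> flags \<tau>" using x(1) by (rule symmetry_flag)
    then have "?y \<in> {(v, e, S) \<in> flags \<tau>. norm v \<le> ?R}" using t(2) by (simp add: flag_act_def)
    ultimately show "X \<in> flag_orbit N ` {(v, e, S) \<in> flags \<tau>. norm v \<le> ?R}" by (rule image_eqI)
  qed
  then have "finite (flag_orbit N ` flags \<tau>)"
    by (rule finite_subset) (intro finite_imageI finite_flags)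
  then have "almost_regular \<tau> ?H \<longleftrightarrow> N = symmetries \<tau>"
    unfolding almost_regular_def card1 card2 by (rule flag_orbit_count_eq_iff[OF N])
  also have "\<dots> \<longleftrightarrow> (\<forall>f\<in>symmetries \<tau>. linear_part f ` L = L)"
    unfolding N_def by blast
  finally show ?thesis unfolding invariant_iff .
qed

section \<open>Triangular bases of integer lattices\<close>

definition int_span :: "ivec \<Rightarrow> ivec \<Rightarrow> ivec set" where
  "int_span a b = {(m * fst a + n * fst b, m * snd a + n * snd b) | m n. True}"

lemma cross_combination:
  "cross (m * fst a + n * fst b, m * snd a + n * snd b) b = m * cross a b"
  "cross a (m * fst a + n * fst b, m * snd a + n * snd b) = n * cross a b"
  by (simp_all add: cross_def algebra_simps)

lemma in_lattice_iff:
  assumes "cross a b \<noteq> 0"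
  shows "in_lattice a b x \<longleftrightarrow> x \<in> int_span a b"
proof
  assume "in_lattice a b x"
  then obtain m n where mn: "cross x b = cross a b * m" "cross a x = cross a b * n"
    unfolding in_lattice_def by (auto elim!: dvdE)
  have "cross a b * fst x = cross x b * fst a + cross a x * fst b"
    "cross a b * snd x = cross x b * snd a + cross a x * snd b"
    by (simp_all add: cross_def algebra_simps)
  then have "cross a b * fst x = cross a b * (m * fst a + n * fst b)"
    "cross a b * snd x = cross a b * (m * snd a + n * snd b)"
    unfolding mn by (simp_all add: algebra_simps)
  then have "x = (m * fst a + n * fst b, m * snd a + n * snd b)"
    using assms by (simp add: prod_eq_iff)
  then show "x \<in> int_span a b" by (auto simp: int_span_def)
next
  assume "x \<in> int_span a b"
  then show "in_lattice a b x" by (auto simp: int_span_def in_lattice_def cross_combination)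
qed

text \<open>The concatenation is the form to which the list comprehension in \<open>cover_generators\<close> expands.
  Candidates are visited in the order of their first coordinates, so the first hit has the least one.\<close>

lemma sorted_wrt_grid:
  fixes xs :: "int list"
  assumes "sorted_wrt (\<le>) xs"
  shows "sorted_wrt (\<lambda>x y. fst x \<le> fst y) (concat (map (\<lambda>i. map (Pair i) ys) xs))"
  using assms
proof (induction xs)
  case (Cons i xs)
  moreover have "sorted_wrt (\<lambda>_ _. i \<le> i) ys" by (induction ys) auto
  ultimately show ?case by (auto simp: sorted_wrt_append sorted_wrt_map)
qed simp

lemma hd_filter_least:
  assumes "sorted_wrt R xs" "x \<in> set xs" "P x"
  shows "hd (filter P xs) \<in> set xs" "P (hd (filter P xs))" "hd (filter P xs) = x \<or> R (hd (filter P xs)) x"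
  using assms by (induction xs) auto

text \<open>Division with remainder, twice. The first coordinates of \<open>M\<close> are multiples of the least positive one,
  \<open>fst p\<close>, and the vectors of \<open>M\<close> with first coordinate \<open>0\<close> are multiples of \<open>q\<close>. The vectors
  \<open>(n, 0)\<close> and \<open>(0, n)\<close> in \<open>M\<close> ensure that both searches succeed, and allow second coordinates to be
  reduced modulo \<open>n\<close>, so that the bounded search for \<open>p\<close> misses no first coordinate up to \<open>n\<close>.\<close>

lemma hermite_basis:
  fixes M :: "ivec set" and n :: int
  assumes diff: "\<And>x y. x \<in> M \<Longrightarrow> y \<in> M \<Longrightarrow> (fst x - fst y, snd x - snd y) \<in> M"
    and n: "n > 0" and multiples: "\<And>i j. (n * i, n * j) \<in> M"
    and p: "p = hd (filter (\<lambda>x. x \<in> M) [(i, j). i \<leftarrow> [1..n], j \<leftarrow> [0..n - 1]])"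
    and q: "q = hd (filter (\<lambda>x. x \<in> M) [(0, j). j \<leftarrow> [1..n]])"
  shows "M = int_span p q" "cross p q \<noteq> 0"
proof -
  let ?xs = "[(i, j). i \<leftarrow> [1..n], j \<leftarrow> [0..n - 1]]" and ?ys = "[(0::int, j). j \<leftarrow> [1..n]]"
  have xs: "sorted_wrt (\<lambda>x y. fst x \<le> fst y) ?xs"
    using sorted_wrt_grid[of "[1..n]" "[0..n - 1]"] by (simp add: sorted_upto)
  have ys: "sorted_wrt (\<lambda>x y. snd x \<le> snd y) ?ys"
    using sorted_upto[of 1 n] by (simp add: sorted_wrt_map)
  have zero: "(0, 0) \<in> M" using multiples[of 0 0] by simp
  have minus: "(- fst x, - snd x) \<in> M" if "x \<in> M" for x using diff[OF zero that] by simp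
  have add: "(fst x + fst y, snd x + snd y) \<in> M" if "x \<in> M" "y \<in> M" for x y
    using diff[OF that(1) minus[OF that(2)]] by simp
  have mult: "(k * fst x, k * snd x) \<in> M" if x: "x \<in> M" for k x
  proof (induction k rule: int_induct[where k = 0])
    case base
    then show ?case using zero by simp
  next
    case (step1 i)
    then show ?case using add[OF step1(2) x] by (simp add: algebra_simps)
  next
    case (step2 i)
    then show ?case using diff[OF step2(2) x] by (simp add: algebra_simps)
  qed
  have n0: "(n, 0) \<in> M" "(0, n) \<in> M" using multiples[of 1 0] multiples[of 0 1] by simp_all
  have "(n, 0) \<in> set ?xs" using n by (auto simp: image_iff)
  note p' = hd_filter_least[where P = "\<lambda>x. x \<in> M", OF xs this n0(1), folded p]
  have pM: "p \<in> M" and pos: "fst p > 0" using p'(1,2) by auto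
  have "(0, n) \<in> set ?ys" using n by (auto simp: image_iff)
  note q' = hd_filter_least[where P = "\<lambda>x. x \<in> M", OF ys this n0(2), folded q]
  have qM: "q \<in> M" and q0: "fst q = 0" and qpos: "snd q > 0" using q'(1,2) by auto
  have least_p: "fst p \<le> i" if i: "(i, j) \<in> M" "0 < i" "i \<le> n" for i j
  proof -
    have "(i, j mod n) \<in> M"
      using diff[OF i(1) mult[OF n0(2), of "j div n"]] by (simp add: minus_div_mult_eq_mod[symmetric])
    moreover have "(i, j mod n) \<in> set ?xs" using i n by (auto simp: image_iff)
    ultimately show ?thesis using hd_filter_least(3)[OF xs, of "(i, j mod n)" "\<lambda>x. x \<in> M"] p by force
  qed
  have least_q: "snd q \<le> j" if j: "(0, j) \<in> M" "0 < j" "j \<le> n" for j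
  proof -
    have "(0, j) \<in> set ?ys" using j by (auto simp: image_iff)
    then show ?thesis using hd_filter_least(3)[OF ys, of "(0, j)" "\<lambda>x. x \<in> M"] j q by force
  qed
  have p_le: "fst p \<le> n" using least_p[OF n0(1)] n by simp
  have q_le: "snd q \<le> n" using least_q[OF n0(2)] n by simp
  show "M = int_span p q"
  proof
    show "int_span p q \<subseteq> M"
      using add[OF mult[OF pM] mult[OF qM]] by (auto simp: int_span_def)
    show "M \<subseteq> int_span p q"
    proof
      fix x assume x: "x \<in> M"
      define k where "k = fst x div fst p"
      define y where "y = snd x - k * snd p"
      have r: "(fst x mod fst p, y) \<in> M"
        using diff[OF x mult[OF pM, of k]] by (simp add: k_def y_def minus_div_mult_eq_mod)
      have "fst x mod fst p = 0"
      proof (rule ccontr)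
        assume "fst x mod fst p \<noteq> 0"
        then have "0 < fst x mod fst p" using pos by (simp add: order_less_le)
        moreover have lt: "fst x mod fst p < fst p" using pos by simp
        ultimately show False using least_p[OF r] p_le by linarith
      qed
      then have fx: "fst x = k * fst p" and y: "(0, y) \<in> M"
        using r by (auto simp: k_def)
      define l where "l = y div snd q"
      have s: "(0, y mod snd q) \<in> M"
        using diff[OF y mult[OF qM, of l]] q0 by (simp add: l_def minus_div_mult_eq_mod)
      have "y mod snd q = 0"
      proof (rule ccontr)
        assume "y mod snd q \<noteq> 0"
        then have "0 < y mod snd q" using qpos by (simp add: order_less_le)
        moreover have lt: "y mod snd q < snd q" using qpos by simp
        ultimately show False using least_q[OF s] q_le by linarith
      qed
      then have "y = l * snd q" by (auto simp: l_def)
      then have "x = (k * fst p + l * fst q, k * snd p + l * snd q)"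
        using fx q0 by (simp add: y_def prod_eq_iff)
      then show "x \<in> int_span p q" by (auto simp: int_span_def)
    qed
  qed
  show "cross p q \<noteq> 0" using pos qpos q0 by (simp add: cross_def)
qed

section \<open>Lattices in coordinates\<close>

lemma lattice_point_diff:
  "lattice_point e1 e2 (fst x - fst y, snd x - snd y) = lattice_point e1 e2 x - lattice_point e1 e2 y"
  by (simp add: lattice_point_def algebra_simps)

lemma lattice_point_combination:
  "lattice_point e1 e2 (m * fst a + n * fst b, m * snd a + n * snd b)
     = lattice_point (lattice_point e1 e2 a) (lattice_point e1 e2 b) (m, n)"
  by (simp add: lattice_point_def algebra_simps)

lemma lattice_point_int_span:
  "lattice_point e1 e2 ` int_span a b = range (lattice_point (lattice_point e1 e2 a) (lattice_point e1 e2 b))"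
proof -
  have "int_span a b = range (\<lambda>x. (fst x * fst a + snd x * fst b, fst x * snd a + snd x * snd b))"
    by (simp add: int_span_def image_def)
  then show ?thesis by (simp add: image_image lattice_point_combination)
qed

lemma Im_cnj_lattice_point:
  "Im (cnj (lattice_point e1 e2 a) * lattice_point e1 e2 b) = of_int (cross a b) * Im (cnj e1 * e2)"
  by (simp add: lattice_point_def cross_def algebra_simps)

lemma inj_lattice_point:
  assumes "Im (cnj e1 * e2) \<noteq> 0"
  shows "inj (lattice_point e1 e2)"
proof
  fix x y assume eq: "lattice_point e1 e2 x = lattice_point e1 e2 y"
  let ?z = "(fst x - fst y, snd x - snd y)"
  have z: "lattice_point e1 e2 ?z = 0" using eq by (simp add: lattice_point_diff)
  have "cross (1, 0) ?z = 0" "cross ?z (0, 1) = 0"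
    using Im_cnj_lattice_point[of e1 e2 "(1, 0)" ?z] Im_cnj_lattice_point[of e1 e2 ?z "(0, 1)"]
      assms unfolding z by simp_all
  then show "x = y" by (simp add: cross_def prod_eq_iff)
qed

lemma linear_part_lattice_point:
  assumes f: "isometry f"
    and p: "linear_part f e1 = lattice_point e1 e2 p" and q: "linear_part f e2 = lattice_point e1 e2 q"
  shows "linear_part f (lattice_point e1 e2 x) = lattice_point e1 e2 (mat_apply (p, q) x)"
proof -
  have "lattice_point e1 e2 x = of_int (fst x) *\<^sub>R e1 + of_int (snd x) *\<^sub>R e2"
    by (simp add: lattice_point_def scaleR_conv_of_real)
  then have "linear_part f (lattice_point e1 e2 x)
      = of_int (fst x) *\<^sub>R linear_part f e1 + of_int (snd x) *\<^sub>R linear_part f e2"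
    using linear_linear_part[OF f] by (simp only: linear_add linear_scale)
  then show ?thesis
    by (simp add: p q scaleR_conv_of_real) (simp add: lattice_point_def mat_apply_def algebra_simps)
qed

lemma in_lattice_diff:
  assumes "in_lattice a b x" "in_lattice a b y"
  shows "in_lattice a b (fst x - fst y, snd x - snd y)"
proof -
  have "cross (fst x - fst y, snd x - snd y) b = cross x b - cross y b"
    "cross a (fst x - fst y, snd x - snd y) = cross a x - cross a y"
    by (simp_all add: cross_def algebra_simps)
  then show ?thesis using assms by (simp add: in_lattice_def)
qed

lemma mat_apply_diff:
  "mat_apply A (fst x - fst y, snd x - snd y)
     = (fst (mat_apply A x) - fst (mat_apply A y), snd (mat_apply A x) - snd (mat_apply A y))"
  by (simp add: mat_apply_def algebra_simps)

lemma in_lattice_multiple: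
  assumes "cross a b dvd n"
  shows "in_lattice a b (mat_apply A (n * i, n * j))"
proof -
  have "mat_apply A (n * i, n * j) = (n * fst (mat_apply A (i, j)), n * snd (mat_apply A (i, j)))"
    by (simp add: mat_apply_def algebra_simps)
  moreover have "cross (n * k, n * l) b = n * cross (k, l) b" "cross a (n * k, n * l) = n * cross a (k, l)" for k l
    by (simp_all add: cross_def algebra_simps)
  ultimately show ?thesis using assms by (simp add: in_lattice_def)
qed

section \<open>The greatest invariant sublattice\<close>

context archimedean_tessellation
begin

lemma translation_symmetries_eq: "(+) t \<in> translation_symmetries \<tau> \<longleftrightarrow> t \<in> \<Lambda>"
  by (auto simp: translation_symmetries_def \<Lambda>_def)

lemma lattice_subset_translations:
  assumes "u \<in> \<Lambda>" "v \<in> \<Lambda>"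
  shows "range (lattice_point u v) \<subseteq> \<Lambda>"
proof -
  have "(+) ` range (lattice_point u v) = generate (Aut \<tau>) {(+) u, (+) v}"
    using translation_group_eq assms by (simp add: \<Lambda>_def translation_group_def)
  also have "\<dots> \<subseteq> carrier (Aut \<tau>)"
    by (rule group.generate_incl[OF group_Aut]) (use assms in \<open>auto simp: \<Lambda>_def Aut_def\<close>)
  finally show ?thesis by (auto simp: \<Lambda>_def Aut_def)
qed

lemma linear_part_translation:
  assumes "f \<in> symmetries \<tau>" "t \<in> \<Lambda>"
  shows "linear_part f t \<in> \<Lambda>"
proof -
  have "(f \<circ> (+) t) \<circ> inv_into UNIV f \<in> symmetries \<tau>"
    using assms symmetry_comp symmetry_inv by (simp add: \<Lambda>_def)
  then show ?thesis by (simp only: conj_translation[OF assms(1)] \<Lambda>_def mem_Collect_eq)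
qed

lemma toroidal_iff:
  "toroidal \<tau> G \<longleftrightarrow> (\<exists>u v. u \<in> \<Lambda> \<and> v \<in> \<Lambda> \<and> Im (cnj u * v) \<noteq> 0 \<and> G = (+) ` range (lattice_point u v))"
proof -
  have eq: "translation_group \<tau> u v = (+) ` range (lattice_point u v)" if "u \<in> \<Lambda>" "v \<in> \<Lambda>" for u v
    using that translation_group_eq by (simp add: \<Lambda>_def)
  show ?thesis
    unfolding toroidal_def translation_symmetries_eq lin_indep_iff
    by (intro ex_cong1 conj_cong refl) (simp only: eq)
qed

lemma almost_regular_lattice:
  assumes "u \<in> \<Lambda>" "v \<in> \<Lambda>" "Im (cnj u * v) \<noteq> 0"
  shows "almost_regular \<tau> ((+) ` range (lattice_point u v)) \<longleftrightarrow>
     (\<forall>f\<in>symmetries \<tau>. \<forall>t\<in>range (lattice_point u v). linear_part f t \<in> range (lattice_point u v))"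
proof (rule almost_regular_iff)
  show "(+) ` range (lattice_point u v) \<subseteq> symmetries \<tau>"
    using lattice_subset_translations[OF assms(1,2)] unfolding \<Lambda>_def by blast
qed (use assms in \<open>auto simp: \<Lambda>_def\<close>)

definition invariant_core :: "complex set \<Rightarrow> complex set" where
  "invariant_core L = {t \<in> \<Lambda>. \<forall>f\<in>symmetries \<tau>. linear_part f t \<in> L}"

lemma invariant_core_subset: "invariant_core L \<subseteq> L"
proof
  fix t assume "t \<in> invariant_core L"
  then have "linear_part id t \<in> L" using symmetry_id by (simp add: invariant_core_def)
  then show "t \<in> L" by (simp add: linear_part_def)
qed

lemma invariant_core_invariant:
  assumes f: "f \<in> symmetries \<tau>" and t: "t \<in> invariant_core L"
  shows "linear_part f t \<in> invariant_core L"
proof -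
  have "linear_part g (linear_part f t) \<in> L" if g: "g \<in> symmetries \<tau>" for g
    using t symmetry_comp[OF g f] linear_part_comp[OF symmetry_isometry[OF g], of f t]
    by (auto simp: invariant_core_def)
  then show ?thesis using linear_part_translation[OF f] t by (simp add: invariant_core_def)
qed

lemma greatest_cover:
  assumes L: "L \<subseteq> \<Lambda>"
    and core: "u \<in> \<Lambda>" "v \<in> \<Lambda>" "Im (cnj u * v) \<noteq> 0" "invariant_core L = range (lattice_point u v)"
  shows "almost_regular_cover \<tau> ((+) ` L) ((+) ` invariant_core L)"
    and "almost_regular_cover \<tau> ((+) ` L) K \<Longrightarrow> K \<subseteq> (+) ` invariant_core L"
proof -
  show "almost_regular_cover \<tau> ((+) ` L) ((+) ` invariant_core L)"
    unfolding almost_regular_cover_def map_le_def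
  proof (intro conjI)
    show "toroidal \<tau> ((+) ` invariant_core L)" unfolding toroidal_iff using core by blast
    show "almost_regular \<tau> ((+) ` invariant_core L)"
      unfolding core(4) almost_regular_lattice[OF core(1-3)]
      using invariant_core_invariant[of _ _ L] unfolding core(4) by blast
    show "(+) ` invariant_core L \<subseteq> (+) ` L" by (intro image_mono invariant_core_subset)
  qed
  assume K: "almost_regular_cover \<tau> ((+) ` L) K"
  then obtain s t where st: "s \<in> \<Lambda>" "t \<in> \<Lambda>" "Im (cnj s * t) \<noteq> 0" and
    K_eq: "K = (+) ` range (lattice_point s t)"
    unfolding almost_regular_cover_def toroidal_iff by blast
  let ?K = "range (lattice_point s t)"
  have "\<forall>f\<in>symmetries \<tau>. \<forall>x\<in>?K. linear_part f x \<in> ?K"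
    using K unfolding almost_regular_cover_def K_eq almost_regular_lattice[OF st] by blast
  moreover have "?K \<subseteq> L"
    using K unfolding almost_regular_cover_def K_eq map_le_def translation_image_subset by blast
  ultimately have "?K \<subseteq> invariant_core L" using L unfolding invariant_core_def by blast
  then show "K \<subseteq> (+) ` invariant_core L" unfolding K_eq by blast
qed

text \<open>Covers are ordered by reverse inclusion, so the greatest group gives the least cover.\<close>

lemma minimal_cover_unique:
  assumes "almost_regular_cover \<tau> G H" "\<And>K. almost_regular_cover \<tau> G K \<Longrightarrow> K \<subseteq> H"
  shows "minimal_almost_regular_cover \<tau> G K \<longleftrightarrow> K = H"
  using assms unfolding minimal_almost_regular_cover_def map_le_def by blast

lemma point_group_matrix:
  assumes \<Lambda>: "\<Lambda> = range (lattice_point e1 e2)" and f: "f \<in> symmetries \<tau>"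
  shows "\<exists>A\<in>point_group_matrices \<tau> e1 e2. \<forall>x.
    linear_part f (lattice_point e1 e2 x) = lattice_point e1 e2 (mat_apply A x)"
proof -
  have "e1 = lattice_point e1 e2 (1, 0)" "e2 = lattice_point e1 e2 (0, 1)"
    by (simp_all add: lattice_point_def)
  then have "e1 \<in> \<Lambda>" "e2 \<in> \<Lambda>" unfolding \<Lambda> by (metis rangeI)+
  then obtain p q where pq: "linear_part f e1 = lattice_point e1 e2 p" "linear_part f e2 = lattice_point e1 e2 q"
    using linear_part_translation[OF f] \<Lambda> by blast
  then have "(p, q) \<in> point_group_matrices \<tau> e1 e2"
    using f by (auto simp: point_group_matrices_def linear_part_def)
  then show ?thesis using linear_part_lattice_point[OF symmetry_isometry[OF f] pq] by blast
qed

lemma point_group_matrixD: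
  assumes A: "A \<in> point_group_matrices \<tau> e1 e2"
  shows "\<exists>f\<in>symmetries \<tau>. \<forall>x. linear_part f (lattice_point e1 e2 x) = lattice_point e1 e2 (mat_apply A x)"
proof -
  obtain p q f where "A = (p, q)" "f \<in> symmetries \<tau>"
    "linear_part f e1 = lattice_point e1 e2 p" "linear_part f e2 = lattice_point e1 e2 q"
    using A by (auto simp: point_group_matrices_def linear_part_def)
  then show ?thesis using linear_part_lattice_point symmetry_isometry by blast
qed

lemma finite_point_group_matrices:
  assumes ind: "Im (cnj e1 * e2) \<noteq> 0" and \<Lambda>: "\<Lambda> = range (lattice_point e1 e2)"
  shows "finite (point_group_matrices \<tau> e1 e2)"
proof -
  define C where "C r = {x. norm (lattice_point e1 e2 x) \<le> r}" for r
  have "finite (C r)" for r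
  proof -
    have "lattice_point e1 e2 ` C r \<subseteq> \<Lambda> \<inter> cball 0 r" by (auto simp: C_def \<Lambda>)
    then have "finite (lattice_point e1 e2 ` C r)" using finite_translations by (rule finite_subset)
    then show ?thesis
      by (rule finite_imageD) (rule inj_on_subset[OF inj_lattice_point[OF ind] subset_UNIV])
  qed
  moreover have "point_group_matrices \<tau> e1 e2 \<subseteq> C (norm e1) \<times> C (norm e2)"
  proof clarify
    fix p q assume "(p, q) \<in> point_group_matrices \<tau> e1 e2"
    then obtain f where f: "f \<in> symmetries \<tau>" and
      pq: "linear_part f e1 = lattice_point e1 e2 p" "linear_part f e2 = lattice_point e1 e2 q"
      by (auto simp: point_group_matrices_def linear_part_def)
    then show "p \<in> C (norm e1) \<and> q \<in> C (norm e2)"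
      using norm_linear_part[OF symmetry_isometry[OF f]] by (metis C_def mem_Collect_eq order_refl)
  qed
  ultimately show ?thesis by (meson finite_SigmaI finite_subset)
qed

lemma symmetry_frame_iff:
  "symmetry_frame \<tau> e1 e2 P \<longleftrightarrow> Im (cnj e1 * e2) \<noteq> 0 \<and> \<Lambda> = range (lattice_point e1 e2) \<and>
     set P = point_group_matrices \<tau> e1 e2"
  by (simp add: symmetry_frame_def lin_indep_iff translation_symmetries_eq)

lemma symmetry_frame_exists: "\<exists>e1 e2 P. symmetry_frame \<tau> e1 e2 P"
proof -
  obtain e1 e2 where e: "Im (cnj e1 * e2) \<noteq> 0" "\<Lambda> = range (lattice_point e1 e2)"
    using translation_lattice_basis .
  then obtain P where "set P = point_group_matrices \<tau> e1 e2"
    using finite_point_group_matrices finite_list by blast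
  then show ?thesis using e symmetry_frame_iff by blast
qed

text \<open>In coordinates the linear parts of symmetries are exactly the matrices in \<open>P\<close>, so the invariant core
  becomes the set of all integer vectors admissible for \<open>cover_generators\<close>.\<close>

lemma invariant_core_cover_generators:
  assumes frame: "symmetry_frame \<tau> e1 e2 P"
    and ab: "lin_indep (lattice_point e1 e2 a) (lattice_point e1 e2 b)"
    and a'b': "(a', b') = cover_generators P a b"
  shows "invariant_core (range (lattice_point (lattice_point e1 e2 a) (lattice_point e1 e2 b)))
           = range (lattice_point (lattice_point e1 e2 a') (lattice_point e1 e2 b'))"
    and "Im (cnj (lattice_point e1 e2 a') * lattice_point e1 e2 b') \<noteq> 0"
proof -
  let ?l = "lattice_point e1 e2"
  have ind: "Im (cnj e1 * e2) \<noteq> 0" and \<Lambda>: "\<Lambda> = range ?l" and P: "set P = point_group_matrices \<tau> e1 e2"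
    using frame by (auto simp: symmetry_frame_iff)
  have c: "cross a b \<noteq> 0"
    using ab unfolding lin_indep_iff Im_cnj_lattice_point by simp
  define M where "M = {x. \<forall>A\<in>set P. in_lattice a b (mat_apply A x)}"
  have in_span: "?l x \<in> ?l ` int_span a b \<longleftrightarrow> in_lattice a b x" for x
    unfolding in_lattice_iff[OF c] by (rule inj_image_mem_iff[OF inj_lattice_point[OF ind]])
  have "invariant_core (?l ` int_span a b) = ?l ` M"
  proof -
    have "?l x \<in> invariant_core (?l ` int_span a b) \<longleftrightarrow> x \<in> M" for x
    proof
      assume x: "?l x \<in> invariant_core (?l ` int_span a b)"
      show "x \<in> M" unfolding M_def
      proof clarify
        fix p q assume "(p, q) \<in> set P"
        then obtain f where f: "f \<in> symmetries \<tau>" "linear_part f (?l x) = ?l (mat_apply (p, q) x)"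
          using point_group_matrixD P by blast
        have "linear_part f (?l x) \<in> ?l ` int_span a b" using x f(1) unfolding invariant_core_def by blast
        then show "in_lattice a b (mat_apply (p, q) x)" unfolding f(2) in_span .
      qed
    next
      assume x: "x \<in> M"
      have "linear_part f (?l x) \<in> ?l ` int_span a b" if f: "f \<in> symmetries \<tau>" for f
      proof -
        obtain A where A: "A \<in> set P" "linear_part f (?l x) = ?l (mat_apply A x)"
          using point_group_matrix[OF \<Lambda> f] P by blast
        have "in_lattice a b (mat_apply A x)" using x A(1) by (simp add: M_def)
        then show ?thesis unfolding A(2) in_span .
      qed
      then show "?l x \<in> invariant_core (?l ` int_span a b)" by (simp add: invariant_core_def \<Lambda>)
    qed
    moreover have "invariant_core (?l ` int_span a b) \<subseteq> range ?l" unfolding invariant_core_def \<Lambda> by blast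
    ultimately show ?thesis by blast
  qed
  moreover have M: "M = int_span a' b'" "cross a' b' \<noteq> 0"
  proof -
    have "\<bar>cross a b\<bar> > 0" using c by simp
    moreover have "(fst x - fst y, snd x - snd y) \<in> M" if "x \<in> M" "y \<in> M" for x y
      using that in_lattice_diff by (simp add: M_def mat_apply_diff)
    moreover have "(\<bar>cross a b\<bar> * i, \<bar>cross a b\<bar> * j) \<in> M" for i j
      unfolding M_def using in_lattice_multiple by simp
    moreover have "a' = hd (filter (\<lambda>x. x \<in> M) [(i, j). i \<leftarrow> [1..\<bar>cross a b\<bar>], j \<leftarrow> [0..\<bar>cross a b\<bar> - 1]])"
      "b' = hd (filter (\<lambda>x. x \<in> M) [(0, j). j \<leftarrow> [1..\<bar>cross a b\<bar>]])"
      using a'b' by (simp_all add: cover_generators_def Let_def M_def)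
    ultimately show "M = int_span a' b'" "cross a' b' \<noteq> 0"
      using hermite_basis[of M "\<bar>cross a b\<bar>" a' b'] by blast+
  qed
  ultimately show "invariant_core (range (lattice_point (?l a) (?l b))) = range (lattice_point (?l a') (?l b'))"
    by (simp add: lattice_point_int_span)
  show "Im (cnj (?l a') * ?l b') \<noteq> 0"
    unfolding Im_cnj_lattice_point using M(2) ind by simp
qed

lemma cover_generators_minimal:
  assumes frame: "symmetry_frame \<tau> e1 e2 P"
    and ab: "lin_indep (lattice_point e1 e2 a) (lattice_point e1 e2 b)"
    and a'b': "(a', b') = cover_generators P a b"
  shows "minimal_almost_regular_cover \<tau>
           (translation_group \<tau> (lattice_point e1 e2 a) (lattice_point e1 e2 b)) K \<longleftrightarrow>
         K = translation_group \<tau> (lattice_point e1 e2 a') (lattice_point e1 e2 b')"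
proof -
  let ?l = "lattice_point e1 e2"
  have l: "?l x \<in> \<Lambda>" for x using frame by (simp add: symmetry_frame_iff)
  then have sym: "(+) (?l x) \<in> symmetries \<tau>" for x by (simp add: \<Lambda>_def)
  note core = invariant_core_cover_generators[OF frame ab a'b']
  show ?thesis
    unfolding translation_group_eq[OF sym sym] core(1)[symmetric]
    by (rule minimal_cover_unique)
      (use greatest_cover[OF lattice_subset_translations[OF l l] l l core(2,1)] in blast)+
qed

end

theorem mainTheorem1:
  fixes \<tau> :: "complex set set"
  assumes "archimedean \<tau>"
  shows "(\<forall>G. toroidal \<tau> G \<longrightarrow> (\<exists>!H. minimal_almost_regular_cover \<tau> G H)) \<and>
    (\<exists>e1 e2 P. symmetry_frame \<tau> e1 e2 P) \<and>
    (\<forall>e1 e2 P a b a' b'.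
       symmetry_frame \<tau> e1 e2 P \<longrightarrow>
       lin_indep (lattice_point e1 e2 a) (lattice_point e1 e2 b) \<longrightarrow>
       (a', b') = cover_generators P a b \<longrightarrow>
       minimal_almost_regular_cover \<tau>
         (translation_group \<tau> (lattice_point e1 e2 a) (lattice_point e1 e2 b))
         (translation_group \<tau> (lattice_point e1 e2 a') (lattice_point e1 e2 b')))"
proof -
  interpret archimedean_tessellation \<tau> by unfold_locales (rule assms)
  have unique: "\<exists>!H. minimal_almost_regular_cover \<tau> G H" if G: "toroidal \<tau> G" for G
  proof -
    obtain e1 e2 P where frame: "symmetry_frame \<tau> e1 e2 P" using symmetry_frame_exists by blast
    obtain u v where uv: "u \<in> \<Lambda>" "v \<in> \<Lambda>" "lin_indep u v" "G = translation_group \<tau> u v"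
      using G unfolding toroidal_def translation_symmetries_eq by blast
    obtain a b where ab: "u = lattice_point e1 e2 a" "v = lattice_point e1 e2 b"
      using uv(1,2) frame unfolding symmetry_frame_iff by blast
    obtain a' b' where a'b': "(a', b') = cover_generators P a b" by (metis surj_pair)
    show ?thesis
      using cover_generators_minimal[OF frame _ a'b'] uv(3) unfolding uv(4) ab by blast
  qed
  then show ?thesis using symmetry_frame_exists cover_generators_minimal by blast
qed

end
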